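(* Let $q$ be a prime power, $S\subseteq\mathbb F_q^n$ nonempty, $1\le b\le n$, $0<\tau\le1$, and $0<\delta<1$, and put $\mu=|S|/q^b$. If $$q\ge16(b+2)\qquad\text{and}\qquad \mu\ge\frac{192\,q^2}{\tau^2\delta},$$ then $\beta_S(b,\tau)<\delta$. Moreover, if $q\ge16(b+2)$ and $\mu\ge\frac{192\,q^2}{\tau^2\delta}$, then a uniformly random $b\times n$ matrix over $\mathbb F_q$ (not only a uniformly random surjection) is $\tau$-unbalanced with probability less than $\delta$.
   Context: Let $S\subseteq\mathbb F_q^n$ be nonempty and $\mu=|S|/q^b$. A linear map $L:\mathbb F_q^n\to\mathbb F_q^b$ (equivalently a $b\times n$ matrix over $\mathbb F_q$, not necessarily of full rank) is called $\tau$-balanced (with respect to $S$) if $(1-\tau)\mu\le|S\cap L^{-1}(y)|\le(1+\tau)\mu$ for every $y\in\mathbb F_q^b$, and $\tau$-unbalanced otherwise. $\beta_S(b,\tau)$ denotes the proportion of $\tau$-unbalanced maps among all surjective linear maps $\mathbb F_q^n\to\mathbb F_q^b$. *)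

theory Defs
  imports "HOL-Analysis.Analysis" "HOL-Probability.Probability"
begin

text \<open>
  The field \<open>F\<^sub>q\<close> is a type \<open>'a :: {field, finite}\<close> with \<open>q = CARD('a)\<close>, and the spaces
  \<open>F\<^sub>q\<^sup>n\<close>, \<open>F\<^sub>q\<^sup>b\<close> are \<open>'a ^ 'n\<close>, \<open>'a ^ 'b\<close> with \<open>n = CARD('n)\<close>, \<open>b = CARD('b)\<close>.  Thus \<open>q\<close> is
  automatically a prime power, and \<open>n\<close> and \<open>b\<close> are automatically at least 1.
\<close>

text \<open>The quantity \<open>\<mu> = |S| / q\<^sup>b\<close>; the \<open>itself\<close> argument supplies the index type of the codomain.\<close>

definition mean_fibre :: "'b::finite itself \<Rightarrow> ('a::{field,finite} ^ 'n::finite) set \<Rightarrow> real" where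
  "mean_fibre _ S = real (card S) / real (CARD('a) ^ CARD('b))"

definition balanced ::
    "('a::{field,finite} ^ 'n::finite) set \<Rightarrow> real \<Rightarrow> ('a ^ 'n \<Rightarrow> 'a ^ 'b::finite) \<Rightarrow> bool" where
  "balanced S \<tau> L \<longleftrightarrow>
    (\<forall>y. (1 - \<tau>) * mean_fibre TYPE('b) S \<le> real (card (S \<inter> L -` {y})) \<and>
         real (card (S \<inter> L -` {y})) \<le> (1 + \<tau>) * mean_fibre TYPE('b) S)"

definition linear_surjections :: "('a::{field,finite} ^ 'n::finite \<Rightarrow> 'a ^ 'b::finite) set" where
  "linear_surjections = {L. Vector_Spaces.linear (*s) (*s) L \<and> surj L}"

text \<open>
  The proportion \<open>\<beta>\<^sub>S(b, \<tau>)\<close>.  For \<open>b > n\<close> there are no surjections and the quotient is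
  \<open>0 / 0 = 0\<close>.
\<close>

definition unbalanced_proportion ::
    "'b::finite itself \<Rightarrow> ('a::{field,finite} ^ 'n::finite) set \<Rightarrow> real \<Rightarrow> real" where
  "unbalanced_proportion _ S \<tau> =
    real (card {L \<in> (linear_surjections :: ('a ^ 'n \<Rightarrow> 'a ^ 'b) set). \<not> balanced S \<tau> L}) /
    real (card (linear_surjections :: ('a ^ 'n \<Rightarrow> 'a ^ 'b) set))"

end

theory Submission
  imports Defs "HOL-Computational_Algebra.Polynomial"
begin

text \<open>
  A second moment computation shows that on average few fibres of a random map have the wrong size,
  but the map must be balanced over all \<open>q\<^sup>b\<close> points at once, far too many for a union bound.  The proof replaces the union
  bound by a Kakeya-type theorem for planes.

  Put \<open>m = b + 2\<close>.  A uniformly random \<open>m \<times> n\<close> matrix \<open>M\<close> has fibres of average size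
  \<open>\<nu> = \<mu>/q\<^sup>2 \<ge> 192/(\<tau>\<^sup>2\<delta>)\<close> in \<open>S\<close>, so by the second moment bound (\<open>second_moment\<close>,
  \<open>sum_card_deviating\<close>) the points of \<open>F\<^sub>q\<^sup>m\<close> whose fibre deviates by a factor \<open>\<tau>/2\<close> have expected density
  at most \<open>\<delta>/48\<close>.  Now let \<open>L\<close> consist of the first \<open>b\<close> rows of \<open>M\<close>, and suppose that \<open>L\<close> is unbalanced at
  \<open>y\<close>.  Given \<open>L\<close>, the last two rows are still random and spread the fibre over \<open>y\<close> almost evenly over
  the \<open>q\<^sup>2\<close> points of a plane in \<open>F\<^sub>q\<^sup>m\<close>.  Hence, with conditional probability at least \<open>1/2\<close>, three quarters
  of that plane are deviating points (\<open>unbalanced_extension\<close>).  By symmetry the same holds for every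
  plane direction in place of the coordinate one (\<open>rich_direction_count\<close>).

  So if unbalanced maps were frequent, each plane direction would often be rich, that is, some
  translate of the plane would have three quarters of its points in the sparse set of deviating points.
  A greedy choice of several matrices (\<open>greedy_cover\<close>) amplifies this: the union of their deviating
  sets still has density at most \<open>1/7\<close>, and it is rich in more than half of all directions.  The
  Kakeya-type theorem \<open>rank_two_kakeya\<close> forbids this when \<open>q \<ge> 16 m\<close>.

  The Kakeya-type theorem is proved by the polynomial method with multiplicities.  A polynomial of
  small degree with zeros of high multiplicity on the set, and of slightly smaller multiplicity
  elsewhere, vanishes on every rich plane to high order.  Therefore its leading form vanishes to high
  order at the combinations \<open>v\<^sub>1 + t v\<^sub>2\<close> of the spanning vectors, with \<open>t\<close> outside the field.
  These points fill at least half of a grid of side \<open>q\<^sup>2\<close>, which contradicts the Schwartz-Zippel lemma with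
  multiplicities.

  The estimate for random matrices carries over to random surjections because all but a proportion
  \<open>1/(q - 1)\<close> of the matrices are surjective.
\<close>

section \<open>Polynomials as coefficient functions, and Hasse derivatives\<close>

text \<open>
  A polynomial in the variables \<open>x i\<close>, \<open>i \<in> I\<close>, is represented by its coefficient function \<open>c\<close>
  on exponent vectors; total degree at most \<open>d\<close> means that \<open>c\<close> is supported on \<open>exps I d\<close>.
  Exponents outside \<open>I\<close> are fixed to be 0, so that a vector is determined by its restriction
  to \<open>I\<close>.
\<close>

definition exps :: "'i set \<Rightarrow> nat \<Rightarrow> ('i \<Rightarrow> nat) set" where
  "exps I d = {\<alpha>. (\<forall>i. i \<notin> I \<longrightarrow> \<alpha> i = 0) \<and> sum \<alpha> I \<le> d}"

text \<open>
  The coefficient of \<open>z\<^sup>\<beta>\<close> in the expansion of \<open>c(x + z)\<close>.  Vanishing of all Hasse derivatives of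
  order below \<open>r\<close> is the right meaning of ``zero of multiplicity \<open>r\<close>'' in positive characteristic,
  where iterated partial derivatives lose information.
\<close>

definition hasse ::
    "'i set \<Rightarrow> (('i \<Rightarrow> nat) \<Rightarrow> 'r::comm_ring_1) \<Rightarrow> ('i \<Rightarrow> nat) \<Rightarrow> ('i \<Rightarrow> 'r) \<Rightarrow> 'r" where
  "hasse I c \<beta> x =
    (\<Sum>\<alpha> | c \<alpha> \<noteq> 0. c \<alpha> * (\<Prod>i\<in>I. of_nat (\<alpha> i choose \<beta> i) * x i ^ (\<alpha> i - \<beta> i)))"

lemma finite_exps:
  assumes "finite I"
  shows "finite (exps I d)"
proof -
  have "inj_on (\<lambda>f. restrict f I) (exps I d)"
  proof (rule inj_onI)
    fix f g assume fg: "f \<in> exps I d" "g \<in> exps I d" and eq: "restrict f I = restrict g I"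
    show "f = g"
    proof
      fix i show "f i = g i"
        using fg fun_cong[OF eq, of i] by (cases "i \<in> I") (auto simp: exps_def)
    qed
  qed
  moreover have "(\<lambda>f. restrict f I) ` exps I d \<subseteq> PiE I (\<lambda>_. {..d})"
  proof -
    have "f i \<le> d" if "f \<in> exps I d" "i \<in> I" for f i
      using member_le_sum[of i I f] that assms by (simp add: exps_def)
    then show ?thesis by auto
  qed
  ultimately show ?thesis
    using assms by (meson finite_PiE finite_atMost finite_imageD finite_subset)
qed

lemma hasse_eq_sum:
  assumes "finite E" "\<And>\<alpha>. c \<alpha> \<noteq> 0 \<Longrightarrow> \<alpha> \<in> E"
  shows "hasse I c \<beta> x =
    (\<Sum>\<alpha>\<in>E. c \<alpha> * (\<Prod>i\<in>I. of_nat (\<alpha> i choose \<beta> i) * x i ^ (\<alpha> i - \<beta> i)))"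
  unfolding hasse_def by (rule sum.mono_neutral_left) (use assms in auto)

text \<open>The univariate case: expand \<open>X\<^sup>\<tau> = ((X - x) + x)\<^sup>\<tau>\<close> and collect powers of \<open>X - x\<close>.\<close>

lemma dvd_of_hasse_zero:
  fixes u :: "nat \<Rightarrow> 'r::comm_ring_1"
  assumes "\<And>j. j < k \<Longrightarrow> (\<Sum>\<tau>\<le>t. u \<tau> * (of_nat (\<tau> choose j) * x ^ (\<tau> - j))) = 0"
  shows "[:- x, 1:] ^ k dvd (\<Sum>\<tau>\<le>t. monom (u \<tau>) \<tau>)"
proof -
  define v where "v j = (\<Sum>\<tau>\<le>t. u \<tau> * (of_nat (\<tau> choose j) * x ^ (\<tau> - j)))" for j
  have cp: "[:a:] * [:b:] = [:a * b:]" for a b :: 'r by simp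
  have cs: "(\<Sum>\<tau>\<in>T. [:f \<tau>:]) = [:sum f T:]" for f :: "nat \<Rightarrow> 'r" and T
    by (induction T rule: infinite_finite_induct) auto
  have m: "monom (u \<tau>) \<tau> = (\<Sum>j\<le>t. [:u \<tau> * (of_nat (\<tau> choose j) * x ^ (\<tau> - j)):] * [:- x, 1:] ^ j)"
    if "\<tau> \<le> t" for \<tau>
  proof -
    have "monom (u \<tau>) \<tau> = [:u \<tau>:] * ([:- x, 1:] + [:x:]) ^ \<tau>"
      by (simp add: monom_altdef)
    also have "\<dots> = (\<Sum>j\<le>\<tau>. [:u \<tau>:] * (of_nat (\<tau> choose j) * [:- x, 1:] ^ j * [:x:] ^ (\<tau> - j)))"
      by (simp only: binomial_ring sum_distrib_left)
    also have "\<dots> = (\<Sum>j\<le>\<tau>. [:u \<tau> * (of_nat (\<tau> choose j) * x ^ (\<tau> - j)):] * [:- x, 1:] ^ j)"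
      by (intro sum.cong refl) (simp add: of_nat_poly poly_const_pow ac_simps)
    also have "\<dots> = (\<Sum>j\<le>t. [:u \<tau> * (of_nat (\<tau> choose j) * x ^ (\<tau> - j)):] * [:- x, 1:] ^ j)"
      using that by (intro sum.mono_neutral_left) (auto simp: binomial_eq_0)
    finally show ?thesis .
  qed
  have "(\<Sum>\<tau>\<le>t. monom (u \<tau>) \<tau>) = (\<Sum>j\<le>t. [:v j:] * [:- x, 1:] ^ j)"
  proof -
    have "(\<Sum>\<tau>\<le>t. monom (u \<tau>) \<tau>) =
        (\<Sum>\<tau>\<le>t. \<Sum>j\<le>t. [:u \<tau> * (of_nat (\<tau> choose j) * x ^ (\<tau> - j)):] * [:- x, 1:] ^ j)"
      by (intro sum.cong refl m) simp
    also have "\<dots> = (\<Sum>j\<le>t. [:v j:] * [:- x, 1:] ^ j)"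
      unfolding v_def cs[symmetric] sum_distrib_right by (rule sum.swap)
    finally show ?thesis .
  qed
  also have "[:- x, 1:] ^ k dvd \<dots>"
  proof (intro dvd_sum)
    fix j
    show "[:- x, 1:] ^ k dvd [:v j:] * [:- x, 1:] ^ j"
    proof (cases "j < k")
      case True then show ?thesis using assms v_def by simp
    next
      case False then show ?thesis by (intro dvd_mult le_imp_power_dvd) simp
    qed
  qed
  finally show ?thesis .
qed

lemma sum_multiplicities_le_degree:
  fixes u :: "nat \<Rightarrow> 'r::idom"
  assumes "finite A" "u t \<noteq> 0"
    and "\<And>x j. x \<in> A \<Longrightarrow> j < k x \<Longrightarrow>
      (\<Sum>\<tau>\<le>t. u \<tau> * (of_nat (\<tau> choose j) * x ^ (\<tau> - j))) = 0"
  shows "(\<Sum>x\<in>A. k x) \<le> t"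
proof -
  define Q where "Q = (\<Sum>\<tau>\<le>t. monom (u \<tau>) \<tau>)"
  have cQ: "coeff Q n = (if n \<le> t then u n else 0)" for n
    by (simp add: Q_def coeff_sum)
  have Q0: "Q \<noteq> 0" using cQ[of t] assms(2) by auto
  have dQ: "degree Q \<le> t" by (rule degree_le) (simp add: cQ)
  have kx: "k x \<le> order x Q" if "x \<in> A" for x
    using dvd_of_hasse_zero[where k = "k x" and t = t and u = u and x = x] assms(3)[OF that] Q0 order_divides[of x "k x" Q]
    unfolding Q_def by blast
  have "(\<Sum>x\<in>A. k x) \<le> (\<Sum>x\<in>A. order x Q)" by (intro sum_mono kx)
  also have "\<dots> = (\<Sum>x\<in>A. count (proots Q) x)" using Q0 by simp
  also have "\<dots> \<le> size (proots Q)"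
  proof -
    have "(\<Sum>x\<in>A. count (proots Q) x) = (\<Sum>x\<in>A \<inter> set_mset (proots Q). count (proots Q) x)"
      using assms(1) by (intro sum.mono_neutral_right) (auto simp: count_eq_zero_iff simp del: count_proots set_count_proots)
    also have "\<dots> \<le> (\<Sum>x\<in>set_mset (proots Q). count (proots Q) x)"
      by (intro sum_mono2) auto
    finally show ?thesis by (simp add: size_multiset_overloaded_eq)
  qed
  also have "\<dots> \<le> t" using size_proots_le[of Q] dQ by linarith
  finally show ?thesis .
qed

lemma hasse_at_top_exponent:
  assumes "finite I" "\<And>\<alpha>. c \<alpha> \<noteq> 0 \<Longrightarrow> \<alpha> \<in> exps I d" "\<beta> \<in> exps I d" "sum \<beta> I = d"
  shows "hasse I c \<beta> x = c \<beta>"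
proof -
  have "hasse I c \<beta> x = (\<Sum>\<alpha>\<in>exps I d. c \<alpha> * (\<Prod>i\<in>I. of_nat (\<alpha> i choose \<beta> i) * x i ^ (\<alpha> i - \<beta> i)))"
    using finite_exps[OF assms(1)] assms(2) by (rule hasse_eq_sum)
  also have "\<dots> = (\<Sum>\<alpha>\<in>{\<beta>}. c \<alpha> * (\<Prod>i\<in>I. of_nat (\<alpha> i choose \<beta> i) * x i ^ (\<alpha> i - \<beta> i)))"
  proof (rule sum.mono_neutral_right)
    show "finite (exps I d)" "{\<beta>} \<subseteq> exps I d" using finite_exps assms by auto
    show "\<forall>\<alpha>\<in>exps I d - {\<beta>}. c \<alpha> * (\<Prod>i\<in>I. of_nat (\<alpha> i choose \<beta> i) * x i ^ (\<alpha> i - \<beta> i)) = 0"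
    proof
      fix \<alpha> assume a: "\<alpha> \<in> exps I d - {\<beta>}"
      have "\<exists>i\<in>I. \<alpha> i < \<beta> i"
      proof (rule ccontr)
        assume "\<not> (\<exists>i\<in>I. \<alpha> i < \<beta> i)"
        then have ge: "\<forall>i\<in>I. \<beta> i \<le> \<alpha> i" by auto
        moreover have "sum \<alpha> I \<le> sum \<beta> I" using a assms(4) by (simp add: exps_def)
        ultimately have "\<forall>i\<in>I. \<alpha> i = \<beta> i"
          using assms(1) by (metis dual_order.antisym sum_mono sum_mono_inv)
        moreover have "\<forall>i. i \<notin> I \<longrightarrow> \<alpha> i = \<beta> i" using a assms(3) by (simp add: exps_def)
        ultimately have "\<alpha> = \<beta>" by (auto simp: fun_eq_iff)
        then show False using a by simp
      qed
      then have "(\<Prod>i\<in>I. of_nat (\<alpha> i choose \<beta> i) * x i ^ (\<alpha> i - \<beta> i)) = 0"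
        using assms(1) by (intro prod_zero) (auto intro!: bexI simp: binomial_eq_0)
      then show "c \<alpha> * (\<Prod>i\<in>I. of_nat (\<alpha> i choose \<beta> i) * x i ^ (\<alpha> i - \<beta> i)) = 0" by simp
    qed
  qed
  also have "\<dots> = c \<beta>" by simp
  finally show ?thesis .
qed

text \<open>An exponent of maximal degree in the support gives a derivative that is a nonzero constant.\<close>

lemma exists_hasse_nonzero:
  assumes "finite I" "\<And>\<alpha>. c \<alpha> \<noteq> 0 \<Longrightarrow> \<alpha> \<in> exps I d" "c e \<noteq> 0"
  shows "\<exists>\<beta>. hasse I c \<beta> x \<noteq> 0"
proof -
  have fin: "finite {\<alpha>. c \<alpha> \<noteq> 0}"
    by (rule finite_subset[OF _ finite_exps[OF assms(1), of d]]) (use assms(2) in blast)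
  define D where "D = Max ((\<lambda>\<alpha>. sum \<alpha> I) ` {\<alpha>. c \<alpha> \<noteq> 0})"
  have "D \<in> (\<lambda>\<alpha>. sum \<alpha> I) ` {\<alpha>. c \<alpha> \<noteq> 0}"
    unfolding D_def using fin assms(3) by (intro Max_in) auto
  then obtain \<beta> where b: "c \<beta> \<noteq> 0" "sum \<beta> I = D" by auto
  have "\<alpha> \<in> exps I D" if "c \<alpha> \<noteq> 0" for \<alpha>
    using assms(2)[OF that] that fin unfolding exps_def D_def by (auto intro!: Max_ge)
  then have "hasse I c \<beta> x = c \<beta>" using b assms(1) by (intro hasse_at_top_exponent) auto
  then have "hasse I c \<beta> x \<noteq> 0" using b by simp
  then show ?thesis by (rule exI[of _ \<beta>])
qed

lemma exps_slice:
  assumes "finite I" "i \<notin> I" "\<alpha>(i := t) \<in> exps (insert i I) d" "\<alpha> i = 0"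
  shows "\<alpha> \<in> exps I (d - t)"
proof -
  have "sum (\<alpha>(i := t)) I = sum \<alpha> I" using assms(2) by (intro sum.cong) auto
  then have "t + sum \<alpha> I \<le> d" using assms by (simp add: exps_def)
  moreover have "\<alpha> k = 0" if "k \<notin> I" for k
    using that assms(3,4) by (cases "k = i") (auto simp: exps_def)
  ultimately show ?thesis by (simp add: exps_def)
qed

section \<open>The Schwartz-Zippel lemma with multiplicities\<close>

text \<open>
  Grouping the monomials by their exponent \<open>\<tau>\<close> of the new variable: a mixed Hasse derivative is a
  univariate Hasse derivative of the polynomial whose \<open>\<tau>\<close>-th coefficient is a derivative of the
  \<open>\<tau>\<close>-th slice of \<open>c\<close>.
\<close>

lemma hasse_insert:
  fixes c :: "('i \<Rightarrow> nat) \<Rightarrow> 'r::comm_ring_1"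
  assumes "finite I" "i \<notin> I" "\<And>\<alpha>. c \<alpha> \<noteq> 0 \<Longrightarrow> \<alpha> \<in> exps (insert i I) d" "\<And>\<alpha>. c \<alpha> \<noteq> 0 \<Longrightarrow> \<alpha> i \<le> t"
  shows "hasse (insert i I) c (\<beta>(i := j)) (g(i := x)) =
    (\<Sum>\<tau>\<le>t. hasse I (\<lambda>\<alpha>. if \<alpha> i = 0 then c (\<alpha>(i := \<tau>)) else 0) \<beta> g *
      (of_nat (\<tau> choose j) * x ^ (\<tau> - j)))"
proof -
  define h where "h = (\<lambda>(\<tau>, \<alpha>). \<alpha>(i := \<tau>) :: 'i \<Rightarrow> nat)"
  define P where "P = {..t} \<times> exps I d"
  define F where "F \<alpha> = c \<alpha> * (\<Prod>k\<in>insert i I. of_nat (\<alpha> k choose (\<beta>(i := j)) k) * (g(i := x)) k ^ (\<alpha> k - (\<beta>(i := j)) k))" for \<alpha>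
  have finP: "finite P" unfolding P_def using finite_exps[OF assms(1)] by simp
  have inj: "inj_on h P"
  proof (rule inj_onI, clarsimp simp: h_def P_def exps_def)
    fix a a' :: nat and b b' :: "'i \<Rightarrow> nat"
    assume 1: "\<forall>k. k \<notin> I \<longrightarrow> b k = 0" "\<forall>k. k \<notin> I \<longrightarrow> b' k = 0" and 2: "b(i := a) = b'(i := a')"
    from 2 have "a = a'" by (metis fun_upd_same)
    moreover have "b = b'" using 1 2 assms(2) by (metis fun_upd_triv fun_upd_upd)
    ultimately show "a = a' \<and> b = b'" by simp
  qed
  have supp: "\<alpha> \<in> h ` P" if "c \<alpha> \<noteq> 0" for \<alpha>
  proof -
    have "\<alpha> = h (\<alpha> i, \<alpha>(i := 0))" by (simp add: h_def)
    moreover have "sum (\<alpha>(i := 0)) I = sum \<alpha> I" using assms(2) by (intro sum.cong) auto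
    then have "(\<alpha> i, \<alpha>(i := 0)) \<in> P"
      using assms(3)[OF that] assms(4)[OF that] assms(1,2) by (auto simp: P_def exps_def)
    ultimately show ?thesis by blast
  qed
  have "hasse (insert i I) c (\<beta>(i := j)) (g(i := x)) = (\<Sum>\<alpha>\<in>h ` P. F \<alpha>)"
    unfolding F_def by (rule hasse_eq_sum) (use finP supp in auto)
  also have "\<dots> = (\<Sum>p\<in>P. F (h p))" using inj by (simp add: sum.reindex)
  also have "\<dots> = (\<Sum>\<tau>\<le>t. \<Sum>\<alpha>\<in>exps I d. F (\<alpha>(i := \<tau>)))"
    by (simp add: P_def h_def sum.cartesian_product split_def)
  also have "\<dots> = (\<Sum>\<tau>\<le>t. hasse I (\<lambda>\<alpha>. if \<alpha> i = 0 then c (\<alpha>(i := \<tau>)) else 0) \<beta> g *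
      (of_nat (\<tau> choose j) * x ^ (\<tau> - j)))"
  proof (rule sum.cong[OF refl])
    fix \<tau> assume "\<tau> \<in> {..t}"
    have s: "\<alpha> \<in> exps I d" if "(if \<alpha> i = 0 then c (\<alpha>(i := \<tau>)) else 0) \<noteq> 0" for \<alpha>
    proof -
      have "c (\<alpha>(i := \<tau>)) \<noteq> 0" "\<alpha> i = 0" using that by (auto split: if_splits)
      from exps_slice[OF assms(1,2) assms(3)[OF this(1)] this(2)] show ?thesis
        by (auto simp: exps_def)
    qed
    have F: "F (\<alpha>(i := \<tau>)) = (if \<alpha> i = 0 then c (\<alpha>(i := \<tau>)) else 0) *
        (\<Prod>k\<in>I. of_nat (\<alpha> k choose \<beta> k) * g k ^ (\<alpha> k - \<beta> k)) * (of_nat (\<tau> choose j) * x ^ (\<tau> - j))"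
      if "\<alpha> \<in> exps I d" for \<alpha>
    proof -
      have "\<alpha> i = 0" using that assms(2) by (auto simp: exps_def)
      moreover have "(\<Prod>k\<in>I. of_nat ((\<alpha>(i := \<tau>)) k choose (\<beta>(i := j)) k) * (g(i := x)) k ^ ((\<alpha>(i := \<tau>)) k - (\<beta>(i := j)) k))
          = (\<Prod>k\<in>I. of_nat (\<alpha> k choose \<beta> k) * g k ^ (\<alpha> k - \<beta> k))"
        using assms(2) by (intro prod.cong) auto
      ultimately show ?thesis
        unfolding F_def using assms(1,2) by (simp add: mult_ac)
    qed
    show "(\<Sum>\<alpha>\<in>exps I d. F (\<alpha>(i := \<tau>))) = hasse I (\<lambda>\<alpha>. if \<alpha> i = 0 then c (\<alpha>(i := \<tau>)) else 0) \<beta> g *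
      (of_nat (\<tau> choose j) * x ^ (\<tau> - j))"
      by (subst hasse_eq_sum[OF finite_exps[OF assms(1), of d] s])
        (auto simp: F sum_distrib_right intro!: sum.cong)
  qed
  finally show ?thesis .
qed

text \<open>
  A nonzero polynomial of degree \<open>d\<close> has at most \<open>d * card A ^ (card I - 1)\<close> zeros on the grid
  \<open>A\<^sup>I\<close>, counted with multiplicity; the inequality is multiplied by \<open>card A\<close> so that it also makes
  sense for empty \<open>I\<close>.  In the induction step let \<open>t\<close> be the degree in the new variable and \<open>cc t\<close>
  the leading coefficient, a polynomial of degree at most \<open>d - t\<close> in the old variables.  Over a
  point \<open>g\<close> where \<open>cc t\<close> has multiplicity \<open>N g\<close>, a derivative of order \<open>N g\<close> that does not kill
  \<open>cc t\<close> turns \<open>c\<close> into a univariate polynomial of degree exactly \<open>t\<close>, and lowers multiplicities by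
  at most \<open>N g\<close>.
\<close>

lemma schwartz_zippel_multiplicities:
  fixes c :: "('i \<Rightarrow> nat) \<Rightarrow> 'r::idom"
  assumes "finite I" "finite A" "\<And>\<alpha>. c \<alpha> \<noteq> 0 \<Longrightarrow> \<alpha> \<in> exps I d" "c e \<noteq> 0"
    and "\<And>a \<beta>. a \<in> PiE I (\<lambda>_. A) \<Longrightarrow> sum \<beta> I < r a \<Longrightarrow> hasse I c \<beta> a = 0"
  shows "(\<Sum>a\<in>PiE I (\<lambda>_. A). r a) * card A \<le> d * card A ^ card I"
  using assms(1,3-5)
proof (induction I arbitrary: c d r e rule: finite_induct)
  case empty
  have "r (\<lambda>_. undefined) = 0"
  proof (rule ccontr)
    assume "r (\<lambda>_. undefined) \<noteq> 0"
    then have z: "hasse {} c \<beta> (\<lambda>_. undefined) = 0" for \<beta> by (intro empty.prems(3)) auto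
    moreover have "\<exists>\<beta>. hasse {} c \<beta> (\<lambda>_. undefined) \<noteq> 0"
      by (rule exists_hasse_nonzero[where d = d and e = e]) (use empty.prems in auto)
    ultimately show False by blast
  qed
  then show ?case by simp
next
  case (insert i I)
  have fin: "finite {\<alpha>. c \<alpha> \<noteq> 0}"
    by (rule finite_subset[OF _ finite_exps[of "insert i I" d]])
      (use insert.hyps(1) insert.prems(1) in blast)+
  define t where "t = Max ((\<lambda>\<alpha>. \<alpha> i) ` {\<alpha>. c \<alpha> \<noteq> 0})"
  have "t \<in> (\<lambda>\<alpha>. \<alpha> i) ` {\<alpha>. c \<alpha> \<noteq> 0}"
    unfolding t_def using fin insert.prems(2) by (intro Max_in) auto
  then obtain \<alpha>1 where a1: "c \<alpha>1 \<noteq> 0" "\<alpha>1 i = t" by auto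
  have le_t: "\<alpha> i \<le> t" if "c \<alpha> \<noteq> 0" for \<alpha>
    unfolding t_def using fin that by (intro Max_ge) auto
  define cc where "cc \<tau> \<alpha> = (if \<alpha> i = 0 then c (\<alpha>(i := \<tau>)) else 0)" for \<tau> \<alpha>
  have t_d: "t \<le> d" using insert.prems(1)[OF a1(1)] a1(2) insert.hyps by (auto simp: exps_def)
  have ct: "\<alpha> \<in> exps I (d - t)" if "cc t \<alpha> \<noteq> 0" for \<alpha>
  proof -
    have "c (\<alpha>(i := t)) \<noteq> 0" "\<alpha> i = 0" using that by (auto simp: cc_def split: if_splits)
    then show ?thesis by (intro exps_slice[OF insert.hyps insert.prems(1)])
  qed
  have ct0: "cc t (\<alpha>1(i := 0)) \<noteq> 0" using a1 by (simp add: cc_def) (metis fun_upd_triv)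
  define N where "N g = (LEAST n. \<exists>\<beta>. sum \<beta> I = n \<and> hasse I (cc t) \<beta> g \<noteq> 0)" for g
  have exN: "\<exists>\<beta>. sum \<beta> I = N g \<and> hasse I (cc t) \<beta> g \<noteq> 0" for g
  proof -
    obtain \<beta> where "hasse I (cc t) \<beta> g \<noteq> 0"
      using exists_hasse_nonzero[where c = "cc t" and x = g, OF insert.hyps(1) ct ct0] by metis
    then have "\<exists>\<beta>'. sum \<beta>' I = sum \<beta> I \<and> hasse I (cc t) \<beta>' g \<noteq> 0"
      by (intro exI[of _ \<beta>] conjI refl)
    then show ?thesis
      unfolding N_def by (rule LeastI[where P = "\<lambda>n. \<exists>\<beta>. sum \<beta> I = n \<and> hasse I (cc t) \<beta> g \<noteq> 0"])
  qed
  have ltN: "hasse I (cc t) \<beta> g = 0" if "sum \<beta> I < N g" for \<beta> g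
    using not_less_Least[OF that[unfolded N_def]] by auto
  have IH: "(\<Sum>g\<in>PiE I (\<lambda>_. A). N g) * card A \<le> (d - t) * card A ^ card I"
    by (rule insert.IH[where c = "cc t" and e = "\<alpha>1(i := 0)"]) (fact ct, fact ct0, erule ltN)
  have fibre: "(\<Sum>x\<in>A. r (g(i := x))) \<le> card A * N g + t" if g: "g \<in> PiE I (\<lambda>_. A)" for g
  proof -
    obtain \<beta> where b: "sum \<beta> I = N g" "hasse I (cc t) \<beta> g \<noteq> 0" using exN by blast
    have "(\<Sum>x\<in>A. r (g(i := x)) - N g) \<le> t"
    proof (rule sum_multiplicities_le_degree[where u = "\<lambda>\<tau>. hasse I (cc \<tau>) \<beta> g"])
      fix x j assume x: "x \<in> A" and j: "j < r (g(i := x)) - N g"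
      have "sum (\<beta>(i := j)) (insert i I) = j + sum \<beta> I"
        using insert.hyps by (simp, intro sum.cong) auto
      then have "sum (\<beta>(i := j)) (insert i I) < r (g(i := x))" using j b by simp
      moreover have "g(i := x) \<in> PiE (insert i I) (\<lambda>_. A)" using g x by (auto simp: PiE_def extensional_def)
      ultimately have "hasse (insert i I) c (\<beta>(i := j)) (g(i := x)) = 0" by (rule insert.prems(3)[rotated])
      then show "(\<Sum>\<tau>\<le>t. hasse I (cc \<tau>) \<beta> g * (of_nat (\<tau> choose j) * x ^ (\<tau> - j))) = 0"
        unfolding cc_def[abs_def]
        by (subst (asm) hasse_insert[where t = t and d = d], insert insert.hyps insert.prems(1) le_t) blast+
    qed (use assms b in auto)
    moreover have "(\<Sum>x\<in>A. r (g(i := x))) \<le> (\<Sum>x\<in>A. (r (g(i := x)) - N g) + N g)" by (intro sum_mono) simp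
    ultimately show ?thesis by (simp add: sum.distrib)
  qed
  have cardPi: "card (PiE I (\<lambda>_. A)) = card A ^ card I" using insert.hyps by (simp add: card_PiE)
  have "(\<Sum>a\<in>PiE (insert i I) (\<lambda>_. A). r a) = (\<Sum>(x, g)\<in>A \<times> PiE I (\<lambda>_. A). r (g(i := x)))"
    unfolding PiE_insert_eq using inj_combinator[OF insert.hyps(2), of "\<lambda>_. A"]
    by (simp add: sum.reindex split_def)
  also have "\<dots> = (\<Sum>g\<in>PiE I (\<lambda>_. A). \<Sum>x\<in>A. r (g(i := x)))"
    by (subst sum.swap) (simp add: sum.cartesian_product)
  also have "\<dots> \<le> (\<Sum>g\<in>PiE I (\<lambda>_. A). card A * N g + t)" by (intro sum_mono fibre)
  also have "\<dots> = (\<Sum>g\<in>PiE I (\<lambda>_. A). N g) * card A + t * card A ^ card I"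
    by (simp add: sum.distrib sum_distrib_left cardPi mult.commute)
  also have "\<dots> \<le> (d - t) * card A ^ card I + t * card A ^ card I" using IH by simp
  also have "\<dots> = d * card A ^ card I" using t_d by (simp flip: add_mult_distrib)
  finally have "(\<Sum>a\<in>PiE (insert i I) (\<lambda>_. A). r a) * card A \<le> d * card A ^ card I * card A"
    by (rule mult_le_mono1)
  then show ?case using insert.hyps by (simp add: mult.assoc mult.commute)
qed

section \<open>Taylor expansion and homogeneous forms\<close>

definition ev :: "(('i::finite \<Rightarrow> nat) \<Rightarrow> 'r::comm_ring_1) \<Rightarrow> ('i \<Rightarrow> 'r) \<Rightarrow> 'r" where
  "ev c x = (\<Sum>\<alpha> | c \<alpha> \<noteq> 0. c \<alpha> * (\<Prod>i\<in>UNIV. x i ^ \<alpha> i))"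

lemma ev_eq_sum:
  assumes "finite E" "\<And>\<alpha>. c \<alpha> \<noteq> 0 \<Longrightarrow> \<alpha> \<in> E"
  shows "ev c x = (\<Sum>\<alpha>\<in>E. c \<alpha> * (\<Prod>i\<in>UNIV. x i ^ \<alpha> i))"
  unfolding ev_def by (rule sum.mono_neutral_left) (use assms in auto)

lemma hasse_0: "hasse UNIV c (\<lambda>_. 0) x = ev c x"
  by (simp add: hasse_def ev_def)

lemma hasse_above_degree:
  fixes c :: "('i::finite \<Rightarrow> nat) \<Rightarrow> 'r::comm_ring_1"
  assumes "\<And>\<alpha>. c \<alpha> \<noteq> 0 \<Longrightarrow> \<alpha> \<in> exps UNIV d" "sum \<beta> UNIV > d"
  shows "hasse UNIV c \<beta> x = 0"
proof -
  have "c \<alpha> * (\<Prod>i\<in>UNIV. of_nat (\<alpha> i choose \<beta> i) * x i ^ (\<alpha> i - \<beta> i)) = 0" if "c \<alpha> \<noteq> 0" for \<alpha>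
  proof -
    have "\<exists>i. \<alpha> i < \<beta> i"
    proof (rule ccontr)
      assume "\<nexists>i. \<alpha> i < \<beta> i"
      then have "sum \<beta> UNIV \<le> sum \<alpha> UNIV" by (intro sum_mono) (simp add: not_less)
      then show False using assms(1)[OF that] assms(2) by (simp add: exps_def)
    qed
    then obtain i where "\<alpha> i < \<beta> i" ..
    then have "(\<Prod>i\<in>UNIV. of_nat (\<alpha> i choose \<beta> i) * x i ^ (\<alpha> i - \<beta> i)) = 0"
      by (intro prod_zero bexI[of _ i]) (auto simp: binomial_eq_0)
    then show ?thesis by simp
  qed
  then show ?thesis unfolding hasse_def by (intro sum.neutral) blast
qed

lemma taylor_monomial:
  fixes x z :: "'i::finite \<Rightarrow> 'r::comm_ring_1"
  assumes "\<alpha> \<in> exps UNIV d"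
  shows "(\<Prod>i\<in>UNIV. (x i + z i) ^ \<alpha> i) =
    (\<Sum>\<beta>\<in>exps UNIV d. (\<Prod>i\<in>UNIV. of_nat (\<alpha> i choose \<beta> i) * x i ^ (\<alpha> i - \<beta> i)) * (\<Prod>i\<in>UNIV. z i ^ \<beta> i))"
proof -
  have "(\<Prod>i\<in>UNIV. (x i + z i) ^ \<alpha> i) =
      (\<Prod>i\<in>UNIV. \<Sum>k\<in>{..\<alpha> i}. of_nat (\<alpha> i choose k) * x i ^ (\<alpha> i - k) * z i ^ k)"
  proof (rule prod.cong[OF refl])
    fix i
    have "(x i + z i) ^ \<alpha> i = (z i + x i) ^ \<alpha> i" by (simp add: add.commute)
    also have "\<dots> = (\<Sum>k\<in>{..\<alpha> i}. of_nat (\<alpha> i choose k) * x i ^ (\<alpha> i - k) * z i ^ k)"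
      unfolding binomial_ring by (intro sum.cong refl) (simp only: mult_ac)
    finally show "(x i + z i) ^ \<alpha> i = (\<Sum>k\<in>{..\<alpha> i}. of_nat (\<alpha> i choose k) * x i ^ (\<alpha> i - k) * z i ^ k)" .
  qed
  also have "\<dots> = (\<Sum>\<beta>\<in>PiE UNIV (\<lambda>i. {..\<alpha> i}). \<Prod>i\<in>UNIV. of_nat (\<alpha> i choose \<beta> i) * x i ^ (\<alpha> i - \<beta> i) * z i ^ \<beta> i)"
    by (rule prod_sum_PiE) auto
  also have "\<dots> = (\<Sum>\<beta>\<in>exps UNIV d. \<Prod>i\<in>UNIV. of_nat (\<alpha> i choose \<beta> i) * x i ^ (\<alpha> i - \<beta> i) * z i ^ \<beta> i)"
  proof (rule sum.mono_neutral_left)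
    show "finite (exps (UNIV :: 'i set) d)" by (simp add: finite_exps)
    show "PiE UNIV (\<lambda>i. {..\<alpha> i}) \<subseteq> exps UNIV d"
    proof
      fix \<beta> assume "\<beta> \<in> PiE UNIV (\<lambda>i. {..\<alpha> i})"
      then have "sum \<beta> UNIV \<le> sum \<alpha> UNIV" by (intro sum_mono) auto
      then show "\<beta> \<in> exps UNIV d" using assms by (simp add: exps_def)
    qed
    show "\<forall>\<beta>\<in>exps UNIV d - PiE UNIV (\<lambda>i. {..\<alpha> i}).
        (\<Prod>i\<in>UNIV. of_nat (\<alpha> i choose \<beta> i) * x i ^ (\<alpha> i - \<beta> i) * z i ^ \<beta> i) = 0"
    proof
      fix \<beta> assume "\<beta> \<in> exps UNIV d - PiE UNIV (\<lambda>i. {..\<alpha> i})"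
      then obtain i where "\<alpha> i < \<beta> i" by (auto simp: PiE_UNIV_domain Pi_def not_le)
      then show "(\<Prod>i\<in>UNIV. of_nat (\<alpha> i choose \<beta> i) * x i ^ (\<alpha> i - \<beta> i) * z i ^ \<beta> i) = 0"
        by (intro prod_zero bexI[of _ i]) (auto simp: binomial_eq_0)
    qed
  qed
  finally show ?thesis by (simp add: prod.distrib)
qed

lemma taylor:
  fixes c :: "('i::finite \<Rightarrow> nat) \<Rightarrow> 'r::comm_ring_1"
  assumes "\<And>\<alpha>. c \<alpha> \<noteq> 0 \<Longrightarrow> \<alpha> \<in> exps UNIV d"
  shows "ev c (\<lambda>i. x i + z i) = (\<Sum>\<beta>\<in>exps UNIV d. hasse UNIV c \<beta> x * (\<Prod>i\<in>UNIV. z i ^ \<beta> i))"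
proof -
  have fin: "finite (exps (UNIV :: 'i set) d)" by (simp add: finite_exps)
  have "ev c (\<lambda>i. x i + z i) = (\<Sum>\<alpha>\<in>exps UNIV d. c \<alpha> * (\<Prod>i\<in>UNIV. (x i + z i) ^ \<alpha> i))"
    by (rule ev_eq_sum[OF fin assms])
  also have "\<dots> = (\<Sum>\<alpha>\<in>exps UNIV d. \<Sum>\<beta>\<in>exps UNIV d. c \<alpha> *
      (\<Prod>i\<in>UNIV. of_nat (\<alpha> i choose \<beta> i) * x i ^ (\<alpha> i - \<beta> i)) * (\<Prod>i\<in>UNIV. z i ^ \<beta> i))"
    by (intro sum.cong refl) (simp add: taylor_monomial sum_distrib_left mult.assoc)
  also have "\<dots> = (\<Sum>\<beta>\<in>exps UNIV d. \<Sum>\<alpha>\<in>exps UNIV d. c \<alpha> *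
      (\<Prod>i\<in>UNIV. of_nat (\<alpha> i choose \<beta> i) * x i ^ (\<alpha> i - \<beta> i)) * (\<Prod>i\<in>UNIV. z i ^ \<beta> i))"
    by (rule sum.swap)
  also have "\<dots> = (\<Sum>\<beta>\<in>exps UNIV d. hasse UNIV c \<beta> x * (\<Prod>i\<in>UNIV. z i ^ \<beta> i))"
    by (intro sum.cong refl) (simp add: hasse_eq_sum[OF fin assms] sum_distrib_right)
  finally show ?thesis .
qed

text \<open>
  Over an infinite domain a polynomial function determines its coefficients.  This is what makes it
  possible to read off the Hasse derivatives of a composition from an identity of functions.
\<close>

lemma coefficients_zero:
  fixes c :: "('i::finite \<Rightarrow> nat) \<Rightarrow> 'r::idom"
  assumes "infinite (UNIV :: 'r set)" "\<And>\<alpha>. c \<alpha> \<noteq> 0 \<Longrightarrow> \<alpha> \<in> exps UNIV d" "\<And>x. ev c x = 0"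
  shows "c \<alpha> = 0"
proof (rule ccontr)
  assume nz: "c \<alpha> \<noteq> 0"
  \<comment> \<open>On a grid of side \<open>d + 1\<close> the zeros exceed the Schwartz-Zippel bound.\<close>
  obtain A :: "'r set" where A: "finite A" "card A = Suc d"
    using infinite_arbitrarily_large[OF assms(1)] by blast
  have "(\<Sum>a\<in>PiE (UNIV :: 'i set) (\<lambda>_. A). 1) * card A \<le> d * card A ^ card (UNIV :: 'i set)"
  proof (rule schwartz_zippel_multiplicities[where c = c])
    fix a and \<beta> :: "'i \<Rightarrow> nat" assume "sum \<beta> UNIV < (1::nat)"
    then have "\<beta> = (\<lambda>_. 0)" by (auto simp: fun_eq_iff)
    then show "hasse UNIV c \<beta> a = 0" using assms(3) by (simp add: hasse_0)
  qed (use A assms(2) nz in auto)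
  moreover have "card (PiE (UNIV :: 'i set) (\<lambda>_. A)) = card A ^ card (UNIV :: 'i set)"
    by (simp add: card_PiE)
  ultimately show False using A by simp
qed

text \<open>
  Homogeneous polynomial functions, generated as sums of monomials.  The generation by single
  monomials makes closure under products an easy induction, without any convolution of
  coefficient functions.
\<close>

inductive homogeneous :: "nat \<Rightarrow> (('k::finite \<Rightarrow> 'r::comm_ring_1) \<Rightarrow> 'r) \<Rightarrow> bool" for n where
  homogeneous_zero: "homogeneous n (\<lambda>_. 0)"
| homogeneous_step: "homogeneous n f \<Longrightarrow> sum \<alpha> UNIV = n \<Longrightarrow>
    homogeneous n (\<lambda>s. a * (\<Prod>k\<in>UNIV. s k ^ \<alpha> k) + f s)"

lemma homogeneous_monomial: "sum \<alpha> UNIV = n \<Longrightarrow> homogeneous n (\<lambda>s. a * (\<Prod>k\<in>UNIV. s k ^ \<alpha> k))"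
  using homogeneous_step[OF homogeneous_zero, of \<alpha> n a] by simp

lemma homogeneous_add: "homogeneous n f \<Longrightarrow> homogeneous n g \<Longrightarrow> homogeneous n (\<lambda>s. f s + g s)"
  by (induction rule: homogeneous.induct) (auto simp: add.assoc intro: homogeneous_step)

lemma homogeneous_sum:
  "(\<And>j. j \<in> J \<Longrightarrow> homogeneous n (f j)) \<Longrightarrow> homogeneous n (\<lambda>s. \<Sum>j\<in>J. f j s)"
  by (induction J rule: infinite_finite_induct) (auto intro: homogeneous_zero homogeneous_add)

lemma homogeneous_mult_monomial:
  "homogeneous n f \<Longrightarrow> sum \<alpha> UNIV = m \<Longrightarrow>
    homogeneous (m + n) (\<lambda>s. (a * (\<Prod>k\<in>UNIV. s k ^ \<alpha> k)) * f s)"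
proof (induction rule: homogeneous.induct)
  case homogeneous_zero
  then show ?case by (simp add: homogeneous.homogeneous_zero)
next
  case (homogeneous_step f \<alpha>' a')
  have "homogeneous (m + n) (\<lambda>s. (a * a') * (\<Prod>k\<in>UNIV. s k ^ (\<lambda>k. \<alpha> k + \<alpha>' k) k))"
    by (rule homogeneous_monomial) (use homogeneous_step in \<open>simp add: sum.distrib\<close>)
  from homogeneous_add[OF this homogeneous_step.IH[OF homogeneous_step.prems]]
  show ?case by (simp add: algebra_simps power_add prod.distrib)
qed

lemma homogeneous_mult:
  "homogeneous m f \<Longrightarrow> homogeneous n g \<Longrightarrow> homogeneous (m + n) (\<lambda>s. f s * g s)"
proof (induction rule: homogeneous.induct)
  case homogeneous_zero
  then show ?case by (simp add: homogeneous.homogeneous_zero)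
next
  case (homogeneous_step f \<alpha> a)
  from homogeneous_add[OF homogeneous_mult_monomial[OF homogeneous_step.prems homogeneous_step.hyps(2), of a]
      homogeneous_step.IH[OF homogeneous_step.prems]]
  show ?case by (simp add: algebra_simps)
qed

lemma homogeneous_one: "homogeneous 0 (\<lambda>_. 1)"
  using homogeneous_monomial[of "\<lambda>_. 0" 0 1] by simp

lemma homogeneous_power: "homogeneous m f \<Longrightarrow> homogeneous (m * e) (\<lambda>s. f s ^ e)"
  by (induction e) (auto simp: homogeneous_one dest: homogeneous_mult)

lemma homogeneous_prod:
  "finite J \<Longrightarrow> (\<And>j. j \<in> J \<Longrightarrow> homogeneous (n j) (f j)) \<Longrightarrow> homogeneous (sum n J) (\<lambda>s. \<Prod>j\<in>J. f j s)"
  by (induction J rule: finite_induct) (auto intro: homogeneous_one homogeneous_mult)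

lemma homogeneous_linear: "homogeneous 1 (\<lambda>s. \<Sum>k\<in>UNIV. s k * v k)"
proof (rule homogeneous_sum)
  fix k :: 'a
  have "(\<Prod>j\<in>UNIV. s j ^ (if j = k then 1 else 0)) = s k" for s :: "'a \<Rightarrow> 'b"
    by (subst prod.cong[OF refl, of _ _ "\<lambda>j. if j = k then s j else 1"]) auto
  then show "homogeneous 1 (\<lambda>s. s k * v k)"
    using homogeneous_monomial[of "\<lambda>j. if j = k then 1 else 0" 1 "v k"] by (simp add: mult.commute)
qed

lemma homogeneous_coefficients:
  assumes "homogeneous n f"
  shows "\<exists>L. (\<forall>\<alpha>. L \<alpha> \<noteq> 0 \<longrightarrow> sum \<alpha> UNIV = n) \<and> (\<forall>s. f s = ev L s)"
  using assms
proof (induction rule: homogeneous.induct)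
  case homogeneous_zero
  show ?case by (rule exI[of _ "\<lambda>_. 0"]) (simp add: ev_def)
next
  case (homogeneous_step f \<alpha> a)
  then obtain L where L: "\<And>\<alpha>. L \<alpha> \<noteq> 0 \<Longrightarrow> sum \<alpha> UNIV = n" "\<And>s. f s = ev L s" by blast
  define L' where "L' = L(\<alpha> := a + L \<alpha>)"
  have supp': "sum \<alpha>' UNIV = n" if "L' \<alpha>' \<noteq> 0" for \<alpha>'
    using that L(1) homogeneous_step.hyps(2) by (auto simp: L'_def split: if_splits)
  have "a * (\<Prod>k\<in>UNIV. s k ^ \<alpha> k) + f s = ev L' s" for s
  proof -
    have fin: "finite (exps (UNIV :: 'a set) n)" by (simp add: finite_exps)
    have mem: "\<alpha> \<in> exps UNIV n" using homogeneous_step.hyps(2) by (simp add: exps_def)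
    have "ev L' s = (\<Sum>\<alpha>'\<in>exps UNIV n. L' \<alpha>' * (\<Prod>k\<in>UNIV. s k ^ \<alpha>' k))"
      by (rule ev_eq_sum[OF fin]) (use supp' in \<open>auto simp: exps_def\<close>)
    also have "\<dots> = (\<Sum>\<alpha>'\<in>exps UNIV n. (if \<alpha>' = \<alpha> then a * (\<Prod>k\<in>UNIV. s k ^ \<alpha>' k) else 0) + L \<alpha>' * (\<Prod>k\<in>UNIV. s k ^ \<alpha>' k))"
      by (intro sum.cong refl) (simp add: L'_def algebra_simps)
    also have "\<dots> = a * (\<Prod>k\<in>UNIV. s k ^ \<alpha> k) + (\<Sum>\<alpha>'\<in>exps UNIV n. L \<alpha>' * (\<Prod>k\<in>UNIV. s k ^ \<alpha>' k))"
      using mem fin by (simp add: sum.distrib)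
    also have "(\<Sum>\<alpha>'\<in>exps UNIV n. L \<alpha>' * (\<Prod>k\<in>UNIV. s k ^ \<alpha>' k)) = ev L s"
      by (rule ev_eq_sum[OF fin, symmetric]) (use L(1) in \<open>auto simp: exps_def\<close>)
    finally show ?thesis using L(2) by simp
  qed
  then show ?case using supp' by blast
qed

section \<open>The leading form on the direction of a flat\<close>

lemma linear_form_monomials:
  fixes v :: "'k::finite \<Rightarrow> 'i::finite \<Rightarrow> 'r::comm_ring_1"
  obtains L where "\<And>\<beta> \<alpha>. L \<beta> \<alpha> \<noteq> 0 \<Longrightarrow> sum \<alpha> UNIV = sum \<beta> UNIV"
    "\<And>\<beta> s. (\<Prod>i\<in>UNIV. (\<Sum>k\<in>UNIV. s k * v k i) ^ \<beta> i) = ev (L \<beta>) s"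
proof -
  have "\<exists>L. (\<forall>\<alpha>. L \<alpha> \<noteq> 0 \<longrightarrow> sum \<alpha> UNIV = sum \<beta> UNIV) \<and>
      (\<forall>s. (\<Prod>i\<in>UNIV. (\<Sum>k\<in>UNIV. s k * v k i) ^ \<beta> i) = ev L s)" for \<beta> :: "'i \<Rightarrow> nat"
  proof (rule homogeneous_coefficients, rule homogeneous_prod)
    fix i
    show "homogeneous (\<beta> i) (\<lambda>s. (\<Sum>k\<in>UNIV. s k * v k i) ^ \<beta> i)"
      using homogeneous_power[OF homogeneous_linear, of "\<beta> i" "\<lambda>k. v k i"] by simp
  qed simp
  then show ?thesis using that by metis
qed

text \<open>
  If \<open>c\<close> has degree at most \<open>e\<close> and more zeros on the points \<open>y + \<Sum>k. s k * v k\<close>, \<open>s \<in> A\<^sup>k\<close>, than the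
  Schwartz-Zippel bound permits, then \<open>c\<close> vanishes identically on that flat, hence its degree \<open>e\<close>
  part vanishes on the direction of the flat.  The point of the lemma is that the conclusion holds
  for all parameters \<open>s\<close> of the ring, not only for those with entries in \<open>A\<close>.

  In the proof \<open>T x\<close> is the coefficient function of the polynomial \<open>s \<mapsto> c(x + \<Sum>k. s k * v k)\<close>.
  Comparing \<open>T y\<close> with \<open>T x\<close> for another point \<open>x\<close> of the flat shows that multiplicities of \<open>c\<close> at
  \<open>x\<close> are inherited by the restriction \<open>T y\<close>.
\<close>

lemma top_form_vanishes_on_direction:
  fixes c :: "('i::finite \<Rightarrow> nat) \<Rightarrow> 'r::idom" and v :: "'k::finite \<Rightarrow> 'i \<Rightarrow> 'r"
  assumes inf: "infinite (UNIV :: 'r set)" and supp: "\<And>\<alpha>. c \<alpha> \<noteq> 0 \<Longrightarrow> \<alpha> \<in> exps UNIV e"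
    and "finite A"
    and van: "\<And>s \<beta>. s \<in> PiE UNIV (\<lambda>_. A) \<Longrightarrow> sum \<beta> UNIV < \<rho> s \<Longrightarrow>
      hasse UNIV c \<beta> (\<lambda>i. y i + (\<Sum>k\<in>UNIV. s k * v k i)) = 0"
    and big: "e * card A ^ CARD('k) < (\<Sum>s\<in>PiE UNIV (\<lambda>_. A). \<rho> s) * card A"
  shows "ev (\<lambda>\<alpha>. if sum \<alpha> UNIV = e then c \<alpha> else 0) (\<lambda>i. \<Sum>k\<in>UNIV. s k * v k i) = 0"
proof -
  obtain L where L: "\<And>\<beta> \<alpha>. L \<beta> \<alpha> \<noteq> 0 \<Longrightarrow> sum \<alpha> UNIV = sum \<beta> UNIV"
    "\<And>\<beta> s. (\<Prod>i\<in>UNIV. (\<Sum>k\<in>UNIV. s k * v k i) ^ \<beta> i) = ev (L \<beta>) s"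
    using linear_form_monomials[of v] by blast
  define Ei where "Ei = exps (UNIV :: 'i set) e"
  define Ek where "Ek = exps (UNIV :: 'k set) e"
  have fin: "finite Ei" "finite Ek" by (simp_all add: Ei_def Ek_def finite_exps)
  define T where "T x \<alpha> = (\<Sum>\<beta>\<in>Ei. hasse UNIV c \<beta> x * L \<beta> \<alpha>)" for x \<alpha>
  have LE: "\<alpha> \<in> Ek" if "L \<beta> \<alpha> \<noteq> 0" "\<beta> \<in> Ei" for \<beta> \<alpha>
    using L(1)[OF that(1)] that(2) by (simp add: Ei_def Ek_def exps_def)
  have Tsupp: "\<alpha> \<in> Ek" if "T x \<alpha> \<noteq> 0" for x \<alpha>
  proof -
    have "\<exists>\<beta>\<in>Ei. hasse UNIV c \<beta> x * L \<beta> \<alpha> \<noteq> 0"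
      using that sum.neutral[of Ei "\<lambda>\<beta>. hasse UNIV c \<beta> x * L \<beta> \<alpha>"] unfolding T_def by blast
    then show ?thesis using LE by fastforce
  qed
  have evT: "ev (T x) s = ev c (\<lambda>i. x i + (\<Sum>k\<in>UNIV. s k * v k i))" for x s
  proof -
    have "ev c (\<lambda>i. x i + (\<Sum>k\<in>UNIV. s k * v k i)) = (\<Sum>\<beta>\<in>Ei. hasse UNIV c \<beta> x * ev (L \<beta>) s)"
      unfolding Ei_def L(2)[symmetric] by (rule taylor[OF supp])
    also have "\<dots> = (\<Sum>\<beta>\<in>Ei. \<Sum>\<alpha>\<in>Ek. hasse UNIV c \<beta> x * L \<beta> \<alpha> * (\<Prod>k\<in>UNIV. s k ^ \<alpha> k))"
    proof (rule sum.cong[OF refl])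
      fix \<beta> assume b: "\<beta> \<in> Ei"
      have "ev (L \<beta>) s = (\<Sum>\<alpha>\<in>Ek. L \<beta> \<alpha> * (\<Prod>k\<in>UNIV. s k ^ \<alpha> k))"
        by (rule ev_eq_sum[OF fin(2)]) (rule LE[OF _ b])
      then show "hasse UNIV c \<beta> x * ev (L \<beta>) s =
          (\<Sum>\<alpha>\<in>Ek. hasse UNIV c \<beta> x * L \<beta> \<alpha> * (\<Prod>k\<in>UNIV. s k ^ \<alpha> k))"
        by (simp add: sum_distrib_left mult.assoc)
    qed
    also have "\<dots> = (\<Sum>\<alpha>\<in>Ek. T x \<alpha> * (\<Prod>k\<in>UNIV. s k ^ \<alpha> k))"
      unfolding T_def sum_distrib_right by (rule sum.swap)
    also have "\<dots> = ev (T x) s" by (rule ev_eq_sum[OF fin(2) Tsupp, symmetric])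
    finally show ?thesis by simp
  qed
  have shift: "hasse UNIV (T y) \<beta> s = T (\<lambda>i. y i + (\<Sum>k\<in>UNIV. s k * v k i)) \<beta>" if b: "\<beta> \<in> Ek" for \<beta> s
  proof -
    define x where "x = (\<lambda>i. y i + (\<Sum>k\<in>UNIV. s k * v k i))"
    define W where "W \<beta> = (if \<beta> \<in> Ek then hasse UNIV (T y) \<beta> s - T x \<beta> else 0)" for \<beta>
    have "ev W z = 0" for z
    proof -
      have "ev W z = (\<Sum>\<beta>\<in>Ek. W \<beta> * (\<Prod>k\<in>UNIV. z k ^ \<beta> k))"
        by (rule ev_eq_sum[OF fin(2)]) (simp add: W_def split: if_splits)
      also have "\<dots> = (\<Sum>\<beta>\<in>Ek. hasse UNIV (T y) \<beta> s * (\<Prod>k\<in>UNIV. z k ^ \<beta> k)) -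
          (\<Sum>\<beta>\<in>Ek. T x \<beta> * (\<Prod>k\<in>UNIV. z k ^ \<beta> k))"
        by (simp add: W_def left_diff_distrib sum_subtractf)
      also have "(\<Sum>\<beta>\<in>Ek. hasse UNIV (T y) \<beta> s * (\<Prod>k\<in>UNIV. z k ^ \<beta> k)) = ev (T y) (\<lambda>k. s k + z k)"
        unfolding Ek_def by (rule taylor[symmetric]) (use Tsupp Ek_def in blast)
      also have "(\<Sum>\<beta>\<in>Ek. T x \<beta> * (\<Prod>k\<in>UNIV. z k ^ \<beta> k)) = ev (T x) z"
        by (rule ev_eq_sum[OF fin(2) Tsupp, symmetric])
      also have "ev (T y) (\<lambda>k. s k + z k) = ev (T x) z"
        unfolding evT x_def by (simp only: distrib_right sum.distrib add.assoc)
      finally show ?thesis by simp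
    qed
    then have "W \<beta> = 0"
      by (rule coefficients_zero[OF inf, where d = e, rotated]) (simp add: W_def Ek_def split: if_splits)
    then show ?thesis using b by (simp add: W_def x_def)
  qed
  have T0: "T y \<alpha> = 0" for \<alpha>
  proof (rule ccontr)
    assume nz: "T y \<alpha> \<noteq> 0"
    have "(\<Sum>s\<in>PiE (UNIV :: 'k set) (\<lambda>_. A). \<rho> s) * card A \<le> e * card A ^ card (UNIV :: 'k set)"
    proof (rule schwartz_zippel_multiplicities[where c = "T y"])
      fix s and \<beta> :: "'k \<Rightarrow> nat" assume s: "s \<in> PiE (UNIV :: 'k set) (\<lambda>_. A)" and b: "sum \<beta> UNIV < \<rho> s"
      show "hasse UNIV (T y) \<beta> s = 0"
      proof (cases "\<beta> \<in> Ek")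
        case True
        have "hasse UNIV c \<beta>' (\<lambda>i. y i + (\<Sum>k\<in>UNIV. s k * v k i)) * L \<beta>' \<beta> = 0" for \<beta>'
          using van[OF s, of \<beta>'] L(1)[of \<beta>' \<beta>] b by (cases "L \<beta>' \<beta> = 0") auto
        then show ?thesis unfolding shift[OF True] T_def by (intro sum.neutral ballI)
      next
        case False
        then show ?thesis
          by (intro hasse_above_degree[where d = e]) (use Tsupp in \<open>auto simp: Ek_def exps_def\<close>)
      qed
    qed (use assms(3) nz Tsupp in \<open>auto simp: Ek_def\<close>)
    then show False using big by simp
  qed
  define h where "h \<alpha> = (if sum \<alpha> UNIV = e then c \<alpha> else 0)" for \<alpha>
  have "ev h (\<lambda>i. \<Sum>k\<in>UNIV. s k * v k i) = (\<Sum>\<beta>\<in>Ei. h \<beta> * ev (L \<beta>) s)"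
    unfolding L(2)[symmetric]
    by (rule ev_eq_sum[OF fin(1)]) (use supp in \<open>auto simp: h_def Ei_def split: if_splits\<close>)
  also have "\<dots> = (\<Sum>\<beta>\<in>Ei. \<Sum>\<alpha>\<in>Ek. h \<beta> * L \<beta> \<alpha> * (\<Prod>k\<in>UNIV. s k ^ \<alpha> k))"
  proof (rule sum.cong[OF refl])
    fix \<beta> assume b: "\<beta> \<in> Ei"
    have "ev (L \<beta>) s = (\<Sum>\<alpha>\<in>Ek. L \<beta> \<alpha> * (\<Prod>k\<in>UNIV. s k ^ \<alpha> k))"
      by (rule ev_eq_sum[OF fin(2)]) (rule LE[OF _ b])
    then show "h \<beta> * ev (L \<beta>) s = (\<Sum>\<alpha>\<in>Ek. h \<beta> * L \<beta> \<alpha> * (\<Prod>k\<in>UNIV. s k ^ \<alpha> k))"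
      by (simp add: sum_distrib_left mult.assoc)
  qed
  also have "\<dots> = (\<Sum>\<alpha>\<in>Ek. (\<Sum>\<beta>\<in>Ei. h \<beta> * L \<beta> \<alpha>) * (\<Prod>k\<in>UNIV. s k ^ \<alpha> k))"
    unfolding sum_distrib_right by (rule sum.swap)
  also have "\<dots> = 0"
  proof (rule sum.neutral, rule ballI)
    fix \<alpha>
    have "(\<Sum>\<beta>\<in>Ei. h \<beta> * L \<beta> \<alpha>) = 0"
    proof (cases "sum \<alpha> UNIV = e")
      case True
      have "h \<beta> * L \<beta> \<alpha> = hasse UNIV c \<beta> y * L \<beta> \<alpha>" if "\<beta> \<in> Ei" for \<beta>
      proof (cases "L \<beta> \<alpha> = 0")
        case False
        then have "sum \<beta> UNIV = e" using L(1) True by metis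
        then show ?thesis using hasse_at_top_exponent[where c = c and I = UNIV and d = e] supp that
          by (simp add: h_def Ei_def)
      qed simp
      then have "(\<Sum>\<beta>\<in>Ei. h \<beta> * L \<beta> \<alpha>) = T y \<alpha>" unfolding T_def by (rule sum.cong[OF refl])
      then show ?thesis using T0 by simp
    next
      case False
      then have "h \<beta> * L \<beta> \<alpha> = 0" for \<beta> using L(1)[of \<beta> \<alpha>] by (auto simp: h_def)
      then show ?thesis by (intro sum.neutral ballI)
    qed
    then show "(\<Sum>\<beta>\<in>Ei. h \<beta> * L \<beta> \<alpha>) * (\<Prod>k\<in>UNIV. s k ^ \<alpha> k) = 0" by simp
  qed
  finally show ?thesis by (simp add: h_def[abs_def])
qed

text \<open>
  The Hasse derivative of order \<open>\<gamma>\<close> as a polynomial again; the binomial factors are those for which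
  \<open>hasse UNIV c \<gamma>\<close> is evaluation of \<open>hderiv \<gamma> c\<close>.
\<close>

definition hderiv :: "('i::finite \<Rightarrow> nat) \<Rightarrow> (('i \<Rightarrow> nat) \<Rightarrow> 'r::comm_ring_1) \<Rightarrow> ('i \<Rightarrow> nat) \<Rightarrow> 'r" where
  "hderiv \<gamma> c \<alpha> = of_nat (\<Prod>i\<in>UNIV. (\<alpha> i + \<gamma> i) choose \<gamma> i) * c (\<lambda>i. \<alpha> i + \<gamma> i)"

lemma hderiv_support:
  assumes "\<And>\<alpha>. c \<alpha> \<noteq> 0 \<Longrightarrow> \<alpha> \<in> exps UNIV d" "hderiv \<gamma> c \<alpha> \<noteq> 0"
  shows "\<alpha> \<in> exps UNIV (d - sum \<gamma> UNIV)"
proof -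
  have "c (\<lambda>i. \<alpha> i + \<gamma> i) \<noteq> 0" using assms(2) by (auto simp: hderiv_def)
  from assms(1)[OF this] show ?thesis by (simp add: exps_def sum.distrib)
qed

text \<open>
  Hasse derivatives compose up to a binomial factor, because
  \<open>(\<alpha>+\<gamma> choose \<gamma>) (\<alpha> choose \<beta>) = (\<beta>+\<gamma> choose \<gamma>) (\<alpha>+\<gamma> choose \<beta>+\<gamma>)\<close>.  So a derivative of order \<open>j\<close>
  lowers multiplicities by at most \<open>j\<close>.
\<close>

lemma hasse_hderiv:
  fixes c :: "('i::finite \<Rightarrow> nat) \<Rightarrow> 'r::comm_ring_1"
  assumes supp: "\<And>\<alpha>. c \<alpha> \<noteq> 0 \<Longrightarrow> \<alpha> \<in> exps UNIV d"
  shows "hasse UNIV (hderiv \<gamma> c) \<beta> x =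
    of_nat (\<Prod>i\<in>UNIV. (\<beta> i + \<gamma> i) choose \<gamma> i) * hasse UNIV c (\<lambda>i. \<beta> i + \<gamma> i) x"
proof -
  define E where "E = exps (UNIV :: 'i set) d"
  define h where "h \<alpha> = (\<lambda>i. \<alpha> i + \<gamma> i)" for \<alpha> :: "'i \<Rightarrow> nat"
  have fin: "finite E" by (simp add: E_def finite_exps)
  have inj: "inj_on h E" by (rule inj_onI) (auto simp: h_def fun_eq_iff)
  define F where "F \<alpha> = c \<alpha> * (\<Prod>i\<in>UNIV. of_nat (\<alpha> i choose h \<beta> i) * x i ^ (\<alpha> i - h \<beta> i))" for \<alpha>
  have "hasse UNIV c (h \<beta>) x = (\<Sum>\<alpha>\<in>h ` E \<union> E. F \<alpha>)"
    unfolding F_def by (rule hasse_eq_sum) (use fin supp in \<open>auto simp: E_def\<close>)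
  also have "\<dots> = (\<Sum>\<alpha>\<in>h ` E. F \<alpha>)"
  proof (rule sum.mono_neutral_right)
    show "\<forall>\<alpha>\<in>h ` E \<union> E - h ` E. F \<alpha> = 0"
    proof
      fix \<alpha> assume a: "\<alpha> \<in> h ` E \<union> E - h ` E"
      have "\<exists>i. \<alpha> i < \<gamma> i"
      proof (rule ccontr)
        assume "\<nexists>i. \<alpha> i < \<gamma> i"
        then have "\<alpha> = h (\<lambda>i. \<alpha> i - \<gamma> i)" by (auto simp: h_def fun_eq_iff not_less)
        moreover have "sum (\<lambda>i. \<alpha> i - \<gamma> i) UNIV \<le> sum \<alpha> UNIV" by (intro sum_mono) simp
        then have "(\<lambda>i. \<alpha> i - \<gamma> i) \<in> E" using a unfolding E_def exps_def by auto
        ultimately have "\<alpha> \<in> h ` E" by (rule image_eqI)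
        then show False using a by simp
      qed
      then obtain i where "\<alpha> i < \<gamma> i" ..
      then have "(\<Prod>i\<in>UNIV. of_nat (\<alpha> i choose h \<beta> i) * x i ^ (\<alpha> i - h \<beta> i)) = 0"
        by (intro prod_zero bexI[of _ i]) (auto simp: binomial_eq_0 h_def)
      then show "F \<alpha> = 0" by (simp add: F_def)
    qed
  qed (use fin in auto)
  also have "\<dots> = (\<Sum>\<alpha>\<in>E. F (h \<alpha>))" using inj by (simp add: sum.reindex)
  finally have 1: "hasse UNIV c (h \<beta>) x = (\<Sum>\<alpha>\<in>E. F (h \<alpha>))" .
  have "hasse UNIV (hderiv \<gamma> c) \<beta> x = (\<Sum>\<alpha>\<in>E. hderiv \<gamma> c \<alpha> * (\<Prod>i\<in>UNIV. of_nat (\<alpha> i choose \<beta> i) * x i ^ (\<alpha> i - \<beta> i)))"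
  proof (rule hasse_eq_sum[OF fin])
    fix \<alpha> assume "hderiv \<gamma> c \<alpha> \<noteq> 0"
    from hderiv_support[OF supp this] show "\<alpha> \<in> E" by (auto simp: E_def exps_def)
  qed
  also have "\<dots> = (\<Sum>\<alpha>\<in>E. of_nat (\<Prod>i\<in>UNIV. (\<beta> i + \<gamma> i) choose \<gamma> i) * F (h \<alpha>))"
  proof (rule sum.cong[OF refl])
    fix \<alpha>
    have ch: "((\<alpha> i + \<gamma> i) choose \<gamma> i) * (\<alpha> i choose \<beta> i) =
        ((\<beta> i + \<gamma> i) choose \<gamma> i) * ((\<alpha> i + \<gamma> i) choose (\<beta> i + \<gamma> i))" for i
    proof (cases "\<beta> i \<le> \<alpha> i")
      case True
      then show ?thesis using choose_mult[of "\<gamma> i" "\<beta> i + \<gamma> i" "\<alpha> i + \<gamma> i"] by (simp add: mult.commute)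
    qed (simp add: binomial_eq_0)
    have "of_nat (\<Prod>i\<in>UNIV. (\<alpha> i + \<gamma> i) choose \<gamma> i) * (\<Prod>i\<in>UNIV. of_nat (\<alpha> i choose \<beta> i) * x i ^ (\<alpha> i - \<beta> i))
        = (\<Prod>i\<in>UNIV. of_nat (((\<alpha> i + \<gamma> i) choose \<gamma> i) * (\<alpha> i choose \<beta> i)) * x i ^ (\<alpha> i - \<beta> i))"
      by (simp add: prod.distrib ac_simps)
    also have "\<dots> = of_nat (\<Prod>i\<in>UNIV. (\<beta> i + \<gamma> i) choose \<gamma> i) *
        (\<Prod>i\<in>UNIV. of_nat (h \<alpha> i choose h \<beta> i) * x i ^ (h \<alpha> i - h \<beta> i))"
      unfolding ch by (simp add: prod.distrib ac_simps h_def)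
    finally show "hderiv \<gamma> c \<alpha> * (\<Prod>i\<in>UNIV. of_nat (\<alpha> i choose \<beta> i) * x i ^ (\<alpha> i - \<beta> i)) =
        of_nat (\<Prod>i\<in>UNIV. (\<beta> i + \<gamma> i) choose \<gamma> i) * F (h \<alpha>)"
      unfolding hderiv_def F_def h_def[of \<alpha>, symmetric] by (metis (no_types, lifting) mult.assoc mult.left_commute)
  qed
  finally show ?thesis using 1 by (simp add: h_def sum_distrib_left)
qed

text \<open>
  Applying the previous vanishing result to the derivative of order \<open>\<gamma>\<close>: its degree drops by
  \<open>|\<gamma>|\<close>, its multiplicities drop by at most \<open>|\<gamma>|\<close>, and its leading form is the derivative of the
  leading form of \<open>c\<close>.  Hence the leading form vanishes to high order on the direction of a flat
  that carries enough zeros.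
\<close>

lemma top_form_multiplicity:
  fixes c :: "('i::finite \<Rightarrow> nat) \<Rightarrow> 'r::idom" and v :: "'k::finite \<Rightarrow> 'i \<Rightarrow> 'r"
  assumes inf: "infinite (UNIV :: 'r set)" and supp: "\<And>\<alpha>. c \<alpha> \<noteq> 0 \<Longrightarrow> \<alpha> \<in> exps UNIV d"
    and "finite A"
    and van: "\<And>s \<beta>. s \<in> PiE UNIV (\<lambda>_. A) \<Longrightarrow> sum \<beta> UNIV < \<rho> s \<Longrightarrow>
      hasse UNIV c \<beta> (\<lambda>i. y i + (\<Sum>k\<in>UNIV. s k * v k i)) = 0"
    and big: "(d - sum \<gamma> UNIV) * card A ^ CARD('k) < (\<Sum>s\<in>PiE UNIV (\<lambda>_. A). \<rho> s - sum \<gamma> UNIV) * card A"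
  shows "hasse UNIV (\<lambda>\<alpha>. if sum \<alpha> UNIV = d then c \<alpha> else 0) \<gamma> (\<lambda>i. \<Sum>k\<in>UNIV. s k * v k i) = 0"
proof (cases "sum \<gamma> UNIV \<le> d")
  case False
  then show ?thesis
    by (intro hasse_above_degree[where d = d]) (auto simp: exps_def split: if_splits)
next
  case True
  define h where "h \<alpha> = (if sum \<alpha> UNIV = d then c \<alpha> else 0)" for \<alpha>
  have top: "hderiv \<gamma> h = (\<lambda>\<alpha>. if sum \<alpha> UNIV = d - sum \<gamma> UNIV then hderiv \<gamma> c \<alpha> else 0)"
    using True by (auto simp: fun_eq_iff hderiv_def h_def sum.distrib)
  have "hasse UNIV h \<gamma> x = hasse UNIV (hderiv \<gamma> h) (\<lambda>_. 0) x" for x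
    by (subst hasse_hderiv[where d = d]) (auto simp: h_def exps_def split: if_splits)
  then have "hasse UNIV h \<gamma> (\<lambda>i. \<Sum>k\<in>UNIV. s k * v k i) = ev (hderiv \<gamma> h) (\<lambda>i. \<Sum>k\<in>UNIV. s k * v k i)"
    by (simp add: hasse_0)
  also have "\<dots> = 0"
    unfolding top
  proof (rule top_form_vanishes_on_direction[OF inf _ assms(3) _ big, where y = y])
    fix \<alpha> assume "hderiv \<gamma> c \<alpha> \<noteq> 0"
    then show "\<alpha> \<in> exps UNIV (d - sum \<gamma> UNIV)" by (rule hderiv_support[OF supp, rotated])
  next
    fix s and \<beta> :: "'i \<Rightarrow> nat" assume s: "s \<in> PiE UNIV (\<lambda>_. A)" and b: "sum \<beta> UNIV < \<rho> s - sum \<gamma> UNIV"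
    have "sum (\<lambda>i. \<beta> i + \<gamma> i) UNIV < \<rho> s" using b by (simp add: sum.distrib)
    from van[OF s this]
    show "hasse UNIV (hderiv \<gamma> c) \<beta> (\<lambda>i. y i + (\<Sum>k\<in>UNIV. s k * v k i)) = 0"
      by (subst hasse_hderiv[OF supp]) simp_all
  qed
  finally show ?thesis by (simp add: h_def[abs_def])
qed

section \<open>Interpolation with prescribed multiplicities\<close>

lemma card_exps:
  assumes "finite I"
  shows "card (exps I d) = (d + card I) choose card I"
  using assms
proof (induction I arbitrary: d rule: finite_induct)
  case empty
  have "exps {} d = {\<lambda>_ :: 'a. 0 :: nat}" by (auto simp: exps_def)
  then show ?case by simp
next
  case (insert i I)
  define g where "g = (\<lambda>(\<tau>, \<alpha>). \<alpha>(i := \<tau>) :: 'a \<Rightarrow> nat)"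
  have sI: "sum (\<alpha>(i := \<tau>)) I = sum \<alpha> I" for \<alpha> :: "'a \<Rightarrow> nat" and \<tau>
    using insert.hyps by (intro sum.cong) auto
  have "bij_betw g (SIGMA \<tau>:{..d}. exps I (d - \<tau>)) (exps (insert i I) d)"
  proof (rule bij_betwI[where g = "\<lambda>\<alpha>. (\<alpha> i, \<alpha>(i := 0))"])
    show "g \<in> (SIGMA \<tau>:{..d}. exps I (d - \<tau>)) \<rightarrow> exps (insert i I) d"
      using insert.hyps sI by (auto simp: g_def exps_def)
    show "(\<lambda>\<alpha>. (\<alpha> i, \<alpha>(i := 0))) \<in> exps (insert i I) d \<rightarrow> (SIGMA \<tau>:{..d}. exps I (d - \<tau>))"
      using insert.hyps sI by (auto simp: exps_def)
    show "(g p i, (g p)(i := 0)) = p" if "p \<in> (SIGMA \<tau>:{..d}. exps I (d - \<tau>))" for p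
      using that insert.hyps by (auto simp: g_def exps_def fun_eq_iff)
    show "g (\<alpha> i, \<alpha>(i := 0)) = \<alpha>" for \<alpha> by (simp add: g_def)
  qed
  then have "card (exps (insert i I) d) = card (SIGMA \<tau>:{..d}. exps I (d - \<tau>))"
    by (simp add: bij_betw_same_card)
  also have "\<dots> = (\<Sum>\<tau>\<le>d. (d - \<tau> + card I) choose card I)"
    using insert.hyps by (simp add: insert.IH finite_exps)
  also have "\<dots> = (\<Sum>j\<le>d. (card I + j) choose card I)"
    by (rule sum.reindex_bij_witness[where i = "\<lambda>j. d - j" and j = "\<lambda>j. d - j"]) (auto simp: add.commute)
  also have "\<dots> = (card I + d + 1) choose (card I + 1)"
    by (rule choose_rising_sum(1))
  finally show ?case using insert.hyps by (simp add: add_ac)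
qed

lemma power_le_fact_mult_binomial: "d ^ m \<le> fact m * ((d + m) choose m)"
proof (induction m)
  case (Suc m)
  have "d ^ Suc m \<le> (d + Suc m) * (fact m * ((d + m) choose m))"
    using mult_mono[OF _ Suc.IH, of d "d + Suc m"] by simp
  also have "\<dots> = fact m * (Suc (d + m) * ((d + m) choose m))" by (simp only: mult_ac add_Suc_right)
  also have "\<dots> = fact m * (Suc m * (Suc (d + m) choose Suc m))" by (simp only: Suc_times_binomial)
  also have "\<dots> = fact (Suc m) * ((d + Suc m) choose Suc m)" by (simp only: fact_Suc of_nat_id mult_ac add_Suc_right)
  finally show ?case .
qed simp

lemma fact_mult_card_below_le:
  "fact CARD('i) * card {\<beta> :: 'i::finite \<Rightarrow> nat. sum \<beta> UNIV < r} \<le> (r + CARD('i)) ^ CARD('i)"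
proof (cases r)
  case (Suc r')
  then have "{\<beta> :: 'i \<Rightarrow> nat. sum \<beta> UNIV < r} = exps UNIV r'" by (auto simp: exps_def)
  then have "fact CARD('i) * card {\<beta> :: 'i \<Rightarrow> nat. sum \<beta> UNIV < r} = ((r' + CARD('i)) choose CARD('i)) * fact CARD('i)"
    by (simp add: card_exps)
  also have "\<dots> \<le> (r' + CARD('i)) ^ CARD('i)" by (rule binomial_fact_pow)
  also have "\<dots> \<le> (r + CARD('i)) ^ CARD('i)" using Suc by (intro power_mono) auto
  finally show ?thesis .
qed simp

text \<open>
  Fewer linear conditions than coefficients leave a nonzero solution.  Over a finite field this is
  the pigeonhole principle: two coefficient functions have the same derivatives, and their
  difference is the required polynomial.
\<close>

lemma interpolation_with_multiplicities:
  fixes \<rho> :: "('i::finite \<Rightarrow> 'a::{field,finite}) \<Rightarrow> nat"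
  assumes "(\<Sum>x\<in>UNIV. card {\<beta> :: 'i \<Rightarrow> nat. sum \<beta> UNIV < \<rho> x}) < card (exps (UNIV :: 'i set) d)"
  shows "\<exists>c :: ('i \<Rightarrow> nat) \<Rightarrow> 'a. (\<forall>\<alpha>. c \<alpha> \<noteq> 0 \<longrightarrow> \<alpha> \<in> exps UNIV d) \<and> (\<exists>\<alpha>. c \<alpha> \<noteq> 0) \<and>
    (\<forall>x \<beta>. sum \<beta> UNIV < \<rho> x \<longrightarrow> hasse UNIV c \<beta> x = 0)"
proof -
  define E where "E = exps (UNIV :: 'i set) d"
  define Z where "Z = (SIGMA x:(UNIV :: ('i \<Rightarrow> 'a) set). {\<beta> :: 'i \<Rightarrow> nat. sum \<beta> UNIV < \<rho> x})"
  have fin: "finite E" by (simp add: E_def finite_exps)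
  have finb: "finite {\<beta> :: 'i \<Rightarrow> nat. sum \<beta> UNIV < r}" for r
    by (rule finite_subset[OF _ finite_exps[of UNIV r]]) (auto simp: exps_def)
  have finZ: "finite Z" unfolding Z_def using finb by (intro finite_SigmaI) auto
  have cardZ: "card Z < card E"
    using assms unfolding Z_def E_def by (subst card_SigmaI) (auto intro: finb)
  define H where "H c x \<beta> = (\<Sum>\<alpha>\<in>E. c \<alpha> * (\<Prod>i\<in>UNIV. of_nat (\<alpha> i choose \<beta> i) * x i ^ (\<alpha> i - \<beta> i)))"
    for c and x :: "'i \<Rightarrow> 'a" and \<beta>
  define \<Phi> where "\<Phi> c = restrict (\<lambda>(x, \<beta>). H c x \<beta>) Z" for c
  have "\<not> inj_on \<Phi> (PiE E (\<lambda>_. UNIV :: 'a set))"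
  proof
    assume "inj_on \<Phi> (PiE E (\<lambda>_. UNIV :: 'a set))"
    moreover have "\<Phi> ` (PiE E (\<lambda>_. UNIV :: 'a set)) \<subseteq> PiE Z (\<lambda>_. UNIV)" by (auto simp: \<Phi>_def)
    moreover have "finite (PiE Z (\<lambda>_. UNIV :: 'a set))" using finZ by (intro finite_PiE) auto
    ultimately have "card (PiE E (\<lambda>_. UNIV :: 'a set)) \<le> card (PiE Z (\<lambda>_. UNIV :: 'a set))"
      by (rule card_inj_on_le)
    then have "CARD('a) ^ card E \<le> CARD('a) ^ card Z" using fin finZ by (simp add: card_PiE)
    moreover have "1 < CARD('a)"
      using card_mono[of UNIV "{0, 1 :: 'a}"] by simp
    ultimately show False using cardZ by simp
  qed
  then obtain c1 c2 where c: "c1 \<in> PiE E (\<lambda>_. UNIV)" "c2 \<in> PiE E (\<lambda>_. UNIV)" "\<Phi> c1 = \<Phi> c2" "c1 \<noteq> c2"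
    unfolding inj_on_def by blast
  define c where "c \<alpha> = (if \<alpha> \<in> E then c1 \<alpha> - c2 \<alpha> else 0)" for \<alpha>
  obtain \<alpha> where "c1 \<alpha> \<noteq> c2 \<alpha>" using c(4) by blast
  moreover have "\<alpha> \<in> E" using c(1,2) calculation by (metis PiE_arb)
  ultimately have nz: "c \<alpha> \<noteq> 0" by (simp add: c_def)
  have supp: "\<alpha> \<in> exps UNIV d" if "c \<alpha> \<noteq> 0" for \<alpha>
    using that by (simp add: c_def E_def split: if_splits)
  have "hasse UNIV c \<beta> x = 0" if "sum \<beta> UNIV < \<rho> x" for x \<beta>
  proof -
    have "(x, \<beta>) \<in> Z" using that by (simp add: Z_def)
    then have eq: "H c1 x \<beta> = H c2 x \<beta>" using fun_cong[OF c(3), of "(x, \<beta>)"] by (simp add: \<Phi>_def)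
    have "hasse UNIV c \<beta> x = H c x \<beta>"
      unfolding H_def by (rule hasse_eq_sum[OF fin]) (simp add: c_def split: if_splits)
    also have "\<dots> = H c1 x \<beta> - H c2 x \<beta>"
      by (simp add: H_def c_def left_diff_distrib sum_subtractf)
    finally show ?thesis using eq by simp
  qed
  then show ?thesis using supp nz by blast
qed

lemma hasse_const_poly:
  "hasse UNIV (\<lambda>\<alpha>. [:c \<alpha>:]) \<beta> (\<lambda>i. [:x i:]) = [:hasse UNIV c \<beta> (x :: 'i::finite \<Rightarrow> 'a::comm_ring_1):]"
proof -
  have s: "(\<Sum>j\<in>J. [:f j:]) = [:sum f J:]" for f :: "'b \<Rightarrow> 'a" and J
    by (induction J rule: infinite_finite_induct) auto
  have p: "(\<Prod>j\<in>J. [:f j:]) = [:prod f J:]" for f :: "'i \<Rightarrow> 'a" and J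
    by (induction J rule: infinite_finite_induct) (auto simp: mult.commute)
  have m: "[:a:] * [:b:] = [:a * b:]" for a b :: 'a by simp
  show ?thesis
    by (simp only: hasse_def poly_const_pow of_nat_poly m p s[symmetric] pCons_eq_0_iff simp_thms)
qed

section \<open>Sets that are rich in planes of most directions\<close>

text \<open>
  The numerical choices of the polynomial argument, with \<open>R = 32 m\<^sup>2\<close>.  Prescribe multiplicity
  \<open>R - m\<close> on the set and \<open>R - 65 m\<close> off it; the summand \<open>m\<close> is lost in the estimate of the number of
  conditions, which leaves \<open>R\<close> and \<open>R - 64 m = R (1 - 2/m)\<close>.  A plane with three quarters of its
  points in the set has average multiplicity at least \<open>R - 17 m\<close>, and \<open>R - 21 m\<close> after \<open>4 m\<close>
  derivatives; this times \<open>q\<close> is the permitted degree.  A polynomial with these data exists since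
  \<open>1/7 + (1 - 2/m)\<^sup>m \<le> 1/7 + exp (-2) < 11/32 \<le> (1 - 21/(32 m))\<^sup>m\<close>.  Positive multiplicity also off
  the set is essential: it makes the exponent \<open>m\<close> harmless although a plane may miss a constant
  proportion of the set.
\<close>

lemma kakeya_count:
  fixes q m b :: nat
  assumes "3 \<le> m" "0 < q" "7 * b \<le> q ^ m"
  shows "b * (32 * m\<^sup>2) ^ m + (q ^ m - b) * (32 * m\<^sup>2 - 64 * m) ^ m < (q * (32 * m\<^sup>2 - 21 * m)) ^ m"
proof -
  define R where "R = 32 * real m ^ 2"
  have m0: "0 < real m" "3 \<le> real m" using assms by auto
  have R0: "0 < R" using m0 by (simp add: R_def)
  have mm: "96 * m \<le> 32 * m\<^sup>2" using assms(1) by (simp add: power2_eq_square)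
  have e1: "real (32 * m\<^sup>2) = R" by (simp add: R_def)
  have e2: "real (32 * m\<^sup>2 - 64 * m) = R * (1 - 2 / real m)"
    using mm m0 by (simp add: R_def of_nat_diff field_simps power2_eq_square)
  have e3: "real (32 * m\<^sup>2 - 21 * m) = R * (1 - 21 / (32 * real m))"
    using mm m0 by (simp add: R_def of_nat_diff field_simps power2_eq_square)
  have five: "5 \<le> exp (2 :: real)" using exp_lower_Taylor_quadratic[of "2 :: real"] by simp
  have "(1 - 2 / real m) ^ m \<le> exp (- 2 / real m) ^ m"
    using exp_ge_add_one_self[of "- 2 / real m"] m0 by (intro power_mono) (auto simp: field_simps)
  also have "\<dots> = exp (- 2)" using m0 by (simp flip: exp_of_nat_mult)
  also have "\<dots> \<le> 1 / 5" using five by (simp add: exp_minus field_simps)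
  finally have up: "(1 - 2 / real m) ^ m \<le> 1 / 5" .
  have "1 + real m * (- 21 / (32 * real m)) \<le> (1 + (- 21 / (32 * real m))) ^ m"
    using m0 by (intro Bernoulli_inequality) (simp add: field_simps)
  then have lo: "11 / 32 \<le> (1 - 21 / (32 * real m)) ^ m" using m0 by (simp add: field_simps)
  have b: "real b \<le> real q ^ m / 7" using assms(3) by (simp flip: of_nat_power)
  have b': "b \<le> q ^ m" using assms(3) by simp
  have u0: "0 \<le> (1 - 2 / real m) ^ m" using m0 by (intro zero_le_power) (simp add: field_simps)
  have Q0: "0 < real q ^ m" using assms by simp
  have "real (b * (32 * m\<^sup>2) ^ m + (q ^ m - b) * (32 * m\<^sup>2 - 64 * m) ^ m) =
      real b * R ^ m + (real q ^ m - real b) * (R * (1 - 2 / real m)) ^ m"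
    by (simp only: of_nat_add of_nat_mult of_nat_power of_nat_diff[OF b'] e1[unfolded of_nat_mult of_nat_power] e2 e1)
  also have "\<dots> = R ^ m * (real b + (real q ^ m - real b) * (1 - 2 / real m) ^ m)"
    unfolding power_mult_distrib by (simp only: distrib_left mult_ac)
  also have "real b + (real q ^ m - real b) * (1 - 2 / real m) ^ m \<le> real q ^ m / 7 + real q ^ m * (1 / 5)"
    using b Q0 up u0 by (intro add_mono mult_mono) auto
  also have "real q ^ m / 7 + real q ^ m * (1 / 5) < real q ^ m * (11 / 32)" using Q0 by simp
  also have "\<dots> \<le> real q ^ m * (1 - 21 / (32 * real m)) ^ m" using lo Q0 by (intro mult_left_mono) auto
  finally have "real (b * (32 * m\<^sup>2) ^ m + (q ^ m - b) * (32 * m\<^sup>2 - 64 * m) ^ m)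
      < R ^ m * (real q ^ m * (1 - 21 / (32 * real m)) ^ m)" using R0 by simp
  also have "\<dots> = real ((q * (32 * m\<^sup>2 - 21 * m)) ^ m)"
    by (simp only: of_nat_mult of_nat_power e3 power_mult_distrib) simp
  finally show ?thesis by (simp only: of_nat_less_iff)
qed

text \<open>
  The zeros on a rich plane exceed the Schwartz-Zippel bound for every derivative of order
  \<open>j < 4 m\<close>.  Here \<open>n\<close> is the number of points of the plane in the set and \<open>W\<close> is the sum of the
  multiplicities that remain after \<open>j\<close> derivatives.
\<close>

lemma rich_flat_arith:
  fixes q m d W j n :: nat
  assumes "3 \<le> m" "16 * m \<le> q" "d \<le> q * (32 * m\<^sup>2 - 21 * m)" "j < 4 * m" "3 * q\<^sup>2 \<le> 4 * n" "n \<le> q\<^sup>2"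
    "W + q\<^sup>2 * j \<ge> n * (32 * m\<^sup>2 - m) + (q\<^sup>2 - n) * (32 * m\<^sup>2 - 65 * m)"
  shows "(d - j) * q\<^sup>2 < W * q"
proof -
  have mm: "96 * m \<le> 32 * m\<^sup>2" using assms(1) by (simp add: power2_eq_square)
  obtain t where t: "32 * m\<^sup>2 = 96 * m + t" using mm le_Suc_ex by blast
  have q0: "0 < q" using assms by simp
  have "n * (32 * m\<^sup>2 - m) + (q\<^sup>2 - n) * (32 * m\<^sup>2 - 65 * m) = q\<^sup>2 * (32 * m\<^sup>2 - 65 * m) + n * (64 * m)"
  proof -
    obtain n' where "q\<^sup>2 = n + n'" using assms(6) le_Suc_ex by blast
    moreover have "32 * m\<^sup>2 - m = (32 * m\<^sup>2 - 65 * m) + 64 * m" by (simp add: t)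
    ultimately show ?thesis by (simp only: add_diff_cancel_left' add_mult_distrib add_mult_distrib2)
  qed
  moreover have "q\<^sup>2 * (48 * m) \<le> n * (64 * m)"
    using mult_right_mono[OF assms(5), of "16 * m"] by (simp add: algebra_simps)
  ultimately have "q\<^sup>2 * (32 * m\<^sup>2 - 65 * m) + q\<^sup>2 * (48 * m) \<le> W + q\<^sup>2 * j" using assms(7) by linarith
  then have W: "q\<^sup>2 * (32 * m\<^sup>2 - 17 * m) \<le> W + q\<^sup>2 * j" by (simp add: t algebra_simps)
  obtain j' where j': "4 * m = j + j'" "0 < j'" using assms(4) by (metis less_imp_add_positive)
  have "q\<^sup>2 * (32 * m\<^sup>2 - 21 * m + j') \<le> W"
  proof -
    have "32 * m\<^sup>2 - 17 * m = (32 * m\<^sup>2 - 21 * m + j') + j" using j' by (simp add: t)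
    then show ?thesis using W by (simp only: add_mult_distrib2)
  qed
  then have W2: "q * (q * (32 * m\<^sup>2 - 21 * m + j')) \<le> W" by (simp add: power2_eq_square mult.assoc)
  have "q * (32 * m\<^sup>2 - 21 * m) < q * (32 * m\<^sup>2 - 21 * m + j')" using q0 j' by simp
  then have "d - j < q * (32 * m\<^sup>2 - 21 * m + j')" using assms(3) by linarith
  then have "(d - j) * q * q < q * (32 * m\<^sup>2 - 21 * m + j') * q * q" using q0 by simp
  also have "\<dots> \<le> W * q" using W2 by (simp add: mult_ac)
  finally show ?thesis by (simp add: power2_eq_square mult.assoc)
qed

text \<open>
  A set of density at most \<open>1/7\<close> in \<open>F\<^sub>q\<^sup>m\<close> contains three quarters of a plane in the direction of
  \<open>v True\<close>, \<open>v False\<close> for fewer than half of all pairs \<open>v\<close>.  Suppose otherwise, and take a nonzero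
  polynomial of low degree with the multiplicities above.  By \<open>top_form_multiplicity\<close> its leading form
  \<open>h\<close> vanishes to order \<open>4 m\<close> at \<open>s v\<^sub>1 + t v\<^sub>2\<close> for every rich pair and all parameters \<open>s\<close>, \<open>t\<close> from
  an extension ring.  With \<open>s = 1\<close> and \<open>t\<close> transcendental over the field, the points \<open>v\<^sub>1 + t v\<^sub>2\<close> are
  pairwise distinct and fill at least half of a grid of side \<open>q\<^sup>2\<close>.  So the Schwartz-Zippel lemma is applied with
  side \<open>q\<^sup>2\<close> instead of \<open>q\<close>, and it is this gain, peculiar to planes, that keeps the loss bounded
  as soon as \<open>q\<close> exceeds a constant multiple of \<open>m\<close>.

  The extension ring is the ring of univariate polynomials over the field: the argument needs only
  an infinite domain with an element \<open>t = [:0, 1:]\<close> independent of 1.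
\<close>

theorem rank_two_kakeya:
  fixes B :: "('m::finite \<Rightarrow> 'a::{field,finite}) set"
  assumes m: "3 \<le> CARD('m)" and q: "16 * CARD('m) \<le> CARD('a)"
    and B: "7 * card B \<le> CARD('a) ^ CARD('m)"
  shows "2 * card {v :: bool \<Rightarrow> 'm \<Rightarrow> 'a. \<exists>y. 3 * (CARD('a))\<^sup>2 \<le>
      4 * card {s. (\<lambda>i. y i + (\<Sum>k\<in>UNIV. s k * v k i)) \<in> B}} < CARD('a) ^ (2 * CARD('m))"
    (is "2 * card ?R < _")
proof (rule ccontr)
  assume "\<not> 2 * card ?R < CARD('a) ^ (2 * CARD('m))"
  then have R: "CARD('a) ^ (2 * CARD('m)) \<le> 2 * card ?R" by simp
  define q where "q = CARD('a)"
  define m where "m = CARD('m)"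
  define d0 where "d0 = q * (32 * m\<^sup>2 - 21 * m)"
  define \<rho> where "\<rho> x = (if x \<in> B then 32 * m\<^sup>2 - m else 32 * m\<^sup>2 - 65 * m)" for x
  have q0: "0 < q" by (simp add: q_def)
  have m3: "3 \<le> m" "16 * m \<le> q" using m q by (simp_all add: m_def q_def)
  have mm: "96 * m \<le> 32 * m\<^sup>2" using m3 by (simp add: power2_eq_square)
  have cardU: "card (UNIV :: ('m \<Rightarrow> 'a) set) = q ^ m"
    by (simp add: card_fun q_def m_def)
  have cardB: "card (- B) = q ^ m - card B" by (simp add: Compl_eq_Diff_UNIV card_Diff_subset cardU)
  have "fact m * (\<Sum>x\<in>UNIV. card {\<beta> :: 'm \<Rightarrow> nat. sum \<beta> UNIV < \<rho> x}) \<le> (\<Sum>x\<in>UNIV. (\<rho> x + m) ^ m)"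
    unfolding sum_distrib_left m_def by (intro sum_mono fact_mult_card_below_le)
  also have "\<dots> = (\<Sum>x\<in>B. (\<rho> x + m) ^ m) + (\<Sum>x\<in>- B. (\<rho> x + m) ^ m)"
    by (subst sum.union_disjoint[symmetric]) auto
  also have "\<dots> = card B * (32 * m\<^sup>2) ^ m + (q ^ m - card B) * (32 * m\<^sup>2 - 64 * m) ^ m"
  proof -
    have "32 * m\<^sup>2 - m + m = 32 * m\<^sup>2" "32 * m\<^sup>2 - 65 * m + m = 32 * m\<^sup>2 - 64 * m" using mm by auto
    then show ?thesis by (simp add: \<rho>_def cardB)
  qed
  also have "\<dots> < d0 ^ m"
    unfolding d0_def by (rule kakeya_count) (use m3 q0 B in \<open>auto simp: q_def m_def\<close>)
  also have "\<dots> \<le> fact m * card (exps (UNIV :: 'm set) d0)"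
    using power_le_fact_mult_binomial[of d0 m] by (simp add: card_exps m_def)
  finally have "(\<Sum>x\<in>UNIV. card {\<beta> :: 'm \<Rightarrow> nat. sum \<beta> UNIV < \<rho> x}) < card (exps (UNIV :: 'm set) d0)"
    by simp
  from interpolation_with_multiplicities[OF this] obtain c :: "('m \<Rightarrow> nat) \<Rightarrow> 'a" and \<alpha>0 where c: "\<And>\<alpha>. c \<alpha> \<noteq> 0 \<Longrightarrow> \<alpha> \<in> exps UNIV d0" "c \<alpha>0 \<noteq> 0"
    "\<And>x \<beta>. sum \<beta> UNIV < \<rho> x \<Longrightarrow> hasse UNIV c \<beta> x = 0"
    by blast
  \<comment> \<open>The exact degree \<open>d\<close> replaces the bound \<open>d0\<close>, so that the leading form is nonzero.\<close>
  define d where "d = Max ((\<lambda>\<alpha>. sum \<alpha> UNIV) ` {\<alpha>. c \<alpha> \<noteq> 0})"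
  have finc: "finite {\<alpha>. c \<alpha> \<noteq> 0}"
    by (rule finite_subset[OF _ finite_exps[of UNIV d0]]) (use c(1) in auto)
  have "d \<in> (\<lambda>\<alpha>. sum \<alpha> UNIV) ` {\<alpha>. c \<alpha> \<noteq> 0}"
    unfolding d_def using finc c(2) by (intro Max_in) auto
  then obtain \<alpha>1 where \<alpha>1: "c \<alpha>1 \<noteq> 0" "sum \<alpha>1 UNIV = d" by auto
  have cd: "\<alpha> \<in> exps UNIV d" if "c \<alpha> \<noteq> 0" for \<alpha>
    using that finc unfolding exps_def d_def by (auto intro!: Max_ge)
  have dd0: "d \<le> d0" using c(1)[OF \<alpha>1(1)] \<alpha>1(2) by (simp add: exps_def)
  define C where "C \<alpha> = [:c \<alpha>:]" for \<alpha>
  define h where "h \<alpha> = (if sum \<alpha> UNIV = d then C \<alpha> else 0)" for \<alpha>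
  define P where "P v = (\<lambda>i. [:v True i, v False i:])" for v :: "bool \<Rightarrow> 'm \<Rightarrow> 'a"
  have inf: "infinite (UNIV :: 'a poly set)"
  proof -
    have "inj (\<lambda>n. monom (1 :: 'a) n)"
    proof (rule injI)
      fix i j assume "monom (1 :: 'a) i = monom 1 j"
      then have "degree (monom (1 :: 'a) i) = degree (monom (1 :: 'a) j)" by simp
      then show "i = j" by (simp add: degree_monom_eq)
    qed
    then show ?thesis by (rule infinite_super[OF subset_UNIV range_inj_infinite])
  qed
  have vanish: "hasse UNIV h \<gamma> (P v) = 0" if v: "v \<in> ?R" and g: "sum \<gamma> UNIV < 4 * m" for v \<gamma>
  proof -
    obtain y where y: "3 * q\<^sup>2 \<le> 4 * card {s. (\<lambda>i. y i + (\<Sum>k\<in>UNIV. s k * v k i)) \<in> B}"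
      using v by (auto simp: q_def)
    define pt where "pt s = (\<lambda>i. y i + (\<Sum>k\<in>UNIV. s k * v k i))" for s
    define n where "n = card {s. pt s \<in> B}"
    define A where "A = range (\<lambda>a :: 'a. [:a:])"
    define \<iota> where "\<iota> s = (\<lambda>k. [:s k:])" for s :: "bool \<Rightarrow> 'a"
    have cs: "(\<Sum>k\<in>UNIV. [:f k:]) = [:sum f UNIV:]" for f :: "bool \<Rightarrow> 'a" by (simp add: UNIV_bool)
    have pt_poly: "(\<lambda>i. [:y i:] + (\<Sum>k\<in>UNIV. \<iota> s k * [:v k i:])) = (\<lambda>i. [:pt s i:])" for s
      by (simp add: pt_def \<iota>_def cs mult.commute)
    have grid: "PiE UNIV (\<lambda>_. A) = range \<iota>"
    proof (intro equalityI subsetI)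
      fix f assume "f \<in> PiE UNIV (\<lambda>_ :: bool. A)"
      then have "\<forall>k. \<exists>a. f k = [:a:]" by (auto simp: A_def)
      then obtain a where "\<And>k. f k = [:a k:]" by metis
      then have "f = \<iota> a" by (auto simp: \<iota>_def)
      then show "f \<in> range \<iota>" by blast
    qed (auto simp: A_def \<iota>_def)
    have inj\<iota>: "inj \<iota>" by (rule injI) (auto simp: \<iota>_def fun_eq_iff)
    have coeff\<iota>: "(\<lambda>k. coeff (\<iota> s k) 0) = s" for s by (simp add: \<iota>_def)
    have cardA: "card A = q" unfolding A_def q_def by (rule card_image) (auto intro: injI)
    have n2: "card (UNIV :: (bool \<Rightarrow> 'a) set) = q\<^sup>2" by (simp add: card_fun q_def)
    define W where "W = (\<Sum>s\<in>UNIV. \<rho> (pt s) - sum \<gamma> UNIV)"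
    have "hasse UNIV (\<lambda>\<alpha>. if sum \<alpha> UNIV = d then C \<alpha> else 0) \<gamma>
        (\<lambda>i. \<Sum>k\<in>UNIV. (if k then 1 else [:0, 1:]) * [:v k i:]) = 0"
    proof (rule top_form_multiplicity[OF inf, where A = A and y = "\<lambda>i. [:y i:]" and
          \<rho> = "\<lambda>s. \<rho> (pt (\<lambda>k. coeff (s k) 0))"])
      show "\<alpha> \<in> exps UNIV d" if "C \<alpha> \<noteq> 0" for \<alpha> using that by (intro cd) (simp add: C_def)
      show "finite A" by (simp add: A_def)
      show "hasse UNIV C \<beta> (\<lambda>i. [:y i:] + (\<Sum>k\<in>UNIV. s k * [:v k i:])) = 0"
        if s: "s \<in> PiE UNIV (\<lambda>_. A)" and b: "sum \<beta> UNIV < \<rho> (pt (\<lambda>k. coeff (s k) 0))" for s \<beta>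
      proof -
        obtain s' where s': "s = \<iota> s'" using s grid by auto
        have "hasse UNIV c \<beta> (pt s') = 0" using c(3) b by (simp add: s' coeff\<iota>)
        then show ?thesis unfolding s' pt_poly C_def[abs_def] hasse_const_poly by simp
      qed
      have "(\<Sum>s\<in>PiE UNIV (\<lambda>_. A). \<rho> (pt (\<lambda>k. coeff (s k) 0)) - sum \<gamma> UNIV) = W"
        unfolding grid W_def using inj\<iota> by (simp add: sum.reindex coeff\<iota>)
      moreover have "(d - sum \<gamma> UNIV) * q\<^sup>2 < W * q"
      proof (rule rich_flat_arith[OF m3 _ g])
        show "d \<le> q * (32 * m\<^sup>2 - 21 * m)" using dd0 by (simp add: d0_def)
        show "3 * q\<^sup>2 \<le> 4 * n" using y by (simp add: n_def pt_def)
        show "n \<le> q\<^sup>2" unfolding n_def n2[symmetric] by (rule card_mono) auto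
        have "n * (32 * m\<^sup>2 - m) + (q\<^sup>2 - n) * (32 * m\<^sup>2 - 65 * m) =
            (\<Sum>s\<in>{s. pt s \<in> B}. \<rho> (pt s)) + (\<Sum>s\<in>- {s. pt s \<in> B}. \<rho> (pt s))"
          by (simp add: \<rho>_def n_def Compl_eq_Diff_UNIV card_Diff_subset n2)
        also have "\<dots> = (\<Sum>s\<in>UNIV. \<rho> (pt s))"
          by (subst sum.union_disjoint[symmetric]) auto
        also have "\<dots> \<le> (\<Sum>s\<in>UNIV. (\<rho> (pt s) - sum \<gamma> UNIV) + sum \<gamma> UNIV)" by (intro sum_mono) simp
        also have "\<dots> = W + q\<^sup>2 * sum \<gamma> UNIV" by (simp add: W_def sum.distrib n2)
        finally show "n * (32 * m\<^sup>2 - m) + (q\<^sup>2 - n) * (32 * m\<^sup>2 - 65 * m) \<le> W + q\<^sup>2 * sum \<gamma> UNIV" .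
      qed
      ultimately show "(d - sum \<gamma> UNIV) * card A ^ CARD(bool)
          < (\<Sum>s\<in>PiE UNIV (\<lambda>_. A). \<rho> (pt (\<lambda>k. coeff (s k) 0)) - sum \<gamma> UNIV) * card A"
        by (simp add: cardA)
    qed
    moreover have "(\<lambda>i. \<Sum>k\<in>UNIV. (if k then 1 else [:0, 1:]) * [:v k i:]) = P v"
      by (auto simp: P_def UNIV_bool fun_eq_iff)
    ultimately show ?thesis by (simp add: h_def[abs_def])
  qed
  define A where "A = range (\<lambda>(a, b). [:a :: 'a, b:])"
  have cardA: "card A = q\<^sup>2"
  proof -
    have "inj (\<lambda>(a, b). [:a :: 'a, b:])" by (auto intro: injI)
    then have "card A = card (UNIV :: ('a \<times> 'a) set)" unfolding A_def by (rule card_image)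
    then show ?thesis by (simp add: q_def power2_eq_square card_cartesian_product flip: UNIV_Times_UNIV)
  qed
  have Pgrid: "P ` ?R \<subseteq> PiE UNIV (\<lambda>_. A)" by (auto simp: P_def A_def)
  have Pinj: "inj P"
  proof (rule injI)
    fix v w assume "P v = P w"
    then have "v True i = w True i \<and> v False i = w False i" for i by (auto simp: P_def fun_eq_iff)
    then have "v k i = w k i" for k i by (cases k) auto
    then show "v = w" by (simp add: fun_eq_iff)
  qed
  \<comment> \<open>Schwartz-Zippel for the leading form on the grid of side \<open>q\<^sup>2\<close>.\<close>
  define r where "r a = (if a \<in> P ` ?R then 4 * m else 0)" for a
  have "(\<Sum>a\<in>PiE (UNIV :: 'm set) (\<lambda>_. A). r a) * card A \<le> d * card A ^ card (UNIV :: 'm set)"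
  proof (rule schwartz_zippel_multiplicities[where c = h])
    show "finite A" by (simp add: A_def)
    show "h \<alpha>1 \<noteq> 0" using \<alpha>1 by (simp add: h_def C_def)
    show "\<alpha> \<in> exps UNIV d" if "h \<alpha> \<noteq> 0" for \<alpha> using that by (simp add: h_def exps_def split: if_splits)
    show "hasse UNIV h \<beta> a = 0" if "sum \<beta> UNIV < r a" for a \<beta>
      using that vanish by (auto simp: r_def split: if_splits)
  qed simp
  moreover have "(\<Sum>a\<in>PiE (UNIV :: 'm set) (\<lambda>_. A). r a) = 4 * m * card ?R"
  proof -
    have "finite (PiE (UNIV :: 'm set) (\<lambda>_. A))" by (intro finite_PiE) (auto simp: A_def)
    then have "(\<Sum>a\<in>PiE (UNIV :: 'm set) (\<lambda>_. A). r a) = (\<Sum>a\<in>P ` ?R. 4 * m)"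
      unfolding r_def using Pgrid by (subst sum.inter_restrict[symmetric]) (auto simp: Int_absorb1)
    also have "\<dots> = 4 * m * card ?R" using Pinj by (simp add: card_image inj_on_subset)
    finally show ?thesis .
  qed
  ultimately have SZ: "4 * m * card ?R * q\<^sup>2 \<le> d * q ^ (2 * m)"
    by (simp add: cardA m_def power_mult)
  have "q ^ (2 * m) \<le> 2 * card ?R" using R by (simp add: q_def m_def)
  then have "(4 * m * q\<^sup>2) * q ^ (2 * m) \<le> (4 * m * q\<^sup>2) * (2 * card ?R)" by (rule mult_le_mono2)
  also have "\<dots> = 2 * (4 * m * card ?R * q\<^sup>2)" by (simp only: mult_ac)
  also have "\<dots> \<le> 2 * (d * q ^ (2 * m))" using SZ by (rule mult_le_mono2)
  finally have "(4 * m * q\<^sup>2) * q ^ (2 * m) \<le> (2 * d) * q ^ (2 * m)" by (simp only: mult.assoc)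
  then have "4 * m * q\<^sup>2 \<le> 2 * d" using q0 by simp
  also have "\<dots> \<le> 2 * d0" using dd0 by simp
  also have "\<dots> < 2 * (q * (32 * m\<^sup>2))" using q0 m3 mm unfolding d0_def by simp
  also have "\<dots> = 4 * m * q * (16 * m)" by (simp add: power2_eq_square)
  also have "\<dots> \<le> 4 * m * q * q" using m3(2) by (rule mult_le_mono2)
  finally show False by (simp add: power2_eq_square)
qed

section \<open>Random matrices\<close>

text \<open>A uniformly random matrix sends a fixed nonzero vector to a uniformly random vector.\<close>

lemma mult_card_solutions:
  fixes v :: "'a::{field,finite} ^ 'n::finite" and x :: "'a ^ 'k::finite"
  assumes "v \<noteq> 0"
  shows "card {A :: 'a ^ 'n ^ 'k. A *v v = x} * CARD('a) ^ CARD('k) = CARD('a ^ 'n ^ 'k)"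
proof -
  obtain j where j: "v $ j \<noteq> 0" using assms by (auto simp: vec_eq_iff)
  define M where "M y = (\<chi> r c. if c = j then y $ r / v $ j else 0)" for y :: "'a ^ 'k"
  have M: "M y *v v = y" for y
  proof -
    have "(M y *v v) $ r = (\<Sum>c\<in>UNIV. if c = j then y $ r else 0)" for r
    proof -
      have "(M y *v v) $ r = (\<Sum>c\<in>UNIV. (if c = j then y $ r / v $ j else 0) * v $ c)"
        by (simp add: matrix_vector_mult_def M_def)
      also have "\<dots> = (\<Sum>c\<in>UNIV. if c = j then y $ r else 0)"
        using j by (intro sum.cong refl) simp
      finally show ?thesis .
    qed
    then show ?thesis by (simp add: vec_eq_iff)
  qed
  have eq: "card {A :: 'a ^ 'n ^ 'k. A *v v = y} = card {A :: 'a ^ 'n ^ 'k. A *v v = x}" for y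
    by (rule bij_betw_same_card[OF bij_betwI[where f = "\<lambda>A. A - M y + M x" and g = "\<lambda>A. A - M x + M y"]])
      (auto simp: matrix_vector_mult_add_rdistrib matrix_vector_mult_diff_rdistrib M)
  have "CARD('a ^ 'n ^ 'k) = card (\<Union>y. {A :: 'a ^ 'n ^ 'k. A *v v = y})" by (rule arg_cong[of _ _ card]) auto
  also have "\<dots> = (\<Sum>y\<in>UNIV. card {A :: 'a ^ 'n ^ 'k. A *v v = y})"
    by (subst card_UN_disjoint) auto
  also have "\<dots> = card {A :: 'a ^ 'n ^ 'k. A *v v = x} * CARD('a) ^ CARD('k)"
    by (simp add: sum.cong[OF refl eq])
  finally show ?thesis by simp
qed

text \<open>
  The squared fibre sizes add up to the number of colliding pairs, and two distinct points collide
  with probability \<open>q\<^sup>-\<^sup>k\<close>.  Only the sum over all fibres is controlled in this way: a single fibre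
  need not have small variance, as linearly dependent points have dependent images.
\<close>

lemma second_moment:
  fixes T :: "('a::{field,finite} ^ 'n::finite) set"
  shows "(\<Sum>A\<in>(UNIV :: ('a ^ 'n ^ 'k::finite) set). \<Sum>x\<in>UNIV. (real (card {s \<in> T. A *v s = x}) - real (card T) / CARD('a) ^ CARD('k))\<^sup>2)
    \<le> real (card T) * CARD('a ^ 'n ^ 'k)"
proof -
  define t where "t = real (card T)"
  define Q where "Q = real (CARD('a) ^ CARD('k))"
  define N where "N = real CARD('a ^ 'n ^ 'k)"
  have Q0: "0 < Q" by (simp add: Q_def)
  have N0: "0 \<le> N" by (simp add: N_def)
  have t0: "0 \<le> t" by (simp add: t_def)
  have finT: "finite T" by simp
  define w where "w A x = real (card {s \<in> T. A *v s = x})" for A :: "'a ^ 'n ^ 'k" and x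
  have w: "w A x = (\<Sum>s\<in>T. of_bool (A *v s = x))" for A x
    by (simp add: w_def Int_def)
  have w1: "(\<Sum>x\<in>UNIV. w A x) = t" for A
    unfolding w by (subst sum.swap) (simp add: t_def)
  have w2: "(\<Sum>x\<in>UNIV. (w A x)\<^sup>2) = (\<Sum>s\<in>T. \<Sum>s'\<in>T. of_bool (A *v s = A *v s'))" for A
  proof -
    have "(\<Sum>x\<in>UNIV. (w A x)\<^sup>2) = (\<Sum>x\<in>UNIV. \<Sum>s\<in>T. \<Sum>s'\<in>T. of_bool (A *v s = x) * of_bool (A *v s' = x))"
      by (simp only: w power2_eq_square sum_product)
    also have "\<dots> = (\<Sum>s\<in>T. \<Sum>s'\<in>T. \<Sum>x\<in>UNIV. of_bool (A *v s = x) * of_bool (A *v s' = x))"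
      by (subst sum.swap, rule sum.cong[OF refl], rule sum.swap)
    also have "\<dots> = (\<Sum>s\<in>T. \<Sum>s'\<in>T. of_bool (A *v s = A *v s'))"
    proof (intro sum.cong refl)
      fix s s'
      have "(\<Sum>x\<in>UNIV. of_bool (A *v s = x) * of_bool (A *v s' = x)) =
          (\<Sum>x\<in>UNIV. if x = A *v s then of_bool (A *v s' = x) else 0 :: real)"
        by (intro sum.cong) auto
      then show "(\<Sum>x\<in>UNIV. of_bool (A *v s = x) * of_bool (A *v s' = x)) = (of_bool (A *v s = A *v s') :: real)"
        by (simp add: eq_commute)
    qed
    finally show ?thesis .
  qed
  have var: "(\<Sum>x\<in>UNIV. (w A x - t / Q)\<^sup>2) = (\<Sum>x\<in>UNIV. (w A x)\<^sup>2) - t\<^sup>2 / Q" for A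
  proof -
    have "(\<Sum>x\<in>UNIV. (w A x - t / Q)\<^sup>2) = (\<Sum>x\<in>UNIV. (w A x)\<^sup>2 - 2 * (t / Q) * w A x + (t / Q)\<^sup>2)"
      by (intro sum.cong refl) (simp add: power2_diff)
    also have "\<dots> = (\<Sum>x\<in>UNIV. (w A x)\<^sup>2) - 2 * (t / Q) * (\<Sum>x\<in>UNIV. w A x) + Q * (t / Q)\<^sup>2"
      by (simp only: sum.distrib sum_subtractf sum_distrib_left) (simp add: Q_def)
    also have "\<dots> = (\<Sum>x\<in>UNIV. (w A x)\<^sup>2) - t\<^sup>2 / Q"
      using Q0 unfolding w1 by (simp add: field_simps power2_eq_square)
    finally show ?thesis .
  qed
  \<comment> \<open>The term \<open>N / Q\<close> is included on the diagonal as well, so that it cancels against \<open>t\<^sup>2 / Q\<close>.\<close>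
  have coll: "(\<Sum>A\<in>(UNIV :: ('a ^ 'n ^ 'k) set). of_bool (A *v s = A *v s')) \<le> (if s = s' then N else 0) + N / Q"
    for s s' :: "'a ^ 'n"
  proof (cases "s = s'")
    case True
    then show ?thesis using N0 Q0 by (simp add: N_def)
  next
    case False
    have "(\<Sum>A\<in>(UNIV :: ('a ^ 'n ^ 'k) set). of_bool (A *v s = A *v s')) = real (card {A :: 'a ^ 'n ^ 'k. A *v (s - s') = 0})"
      by (simp add: matrix_vector_mult_diff_distrib)
    moreover have "real (card {A :: 'a ^ 'n ^ 'k. A *v (s - s') = 0}) * Q = N"
      using mult_card_solutions[of "s - s'" "0 :: 'a ^ 'k"] False unfolding Q_def N_def
      by (metis of_nat_mult right_minus_eq)
    ultimately show ?thesis using False Q0 by (simp add: field_simps)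
  qed
  have "(\<Sum>A\<in>UNIV. \<Sum>x\<in>UNIV. (w A x - t / Q)\<^sup>2) =
      (\<Sum>s\<in>T. \<Sum>s'\<in>T. \<Sum>A\<in>(UNIV :: ('a ^ 'n ^ 'k) set). of_bool (A *v s = A *v s')) - N * (t\<^sup>2 / Q)"
  proof -
    have "(\<Sum>A\<in>UNIV. \<Sum>s\<in>T. \<Sum>s'\<in>T. of_bool ((A :: 'a ^ 'n ^ 'k) *v s = A *v s') :: real) =
        (\<Sum>s\<in>T. \<Sum>s'\<in>T. \<Sum>A\<in>UNIV. of_bool ((A :: 'a ^ 'n ^ 'k) *v s = A *v s'))"
      by (subst sum.swap, rule sum.cong[OF refl], rule sum.swap)
    then show ?thesis unfolding var w2 by (simp add: sum_subtractf N_def)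
  qed
  also have "\<dots> \<le> (\<Sum>s\<in>T. \<Sum>s'\<in>T. (if s = s' then N else 0) + N / Q) - N * (t\<^sup>2 / Q)"
    by (intro diff_right_mono sum_mono coll)
  also have "\<dots> = t * N"
    by (simp add: sum.distrib t_def power2_eq_square finT algebra_simps)
  finally show ?thesis by (simp add: w_def t_def N_def Q_def)
qed

text \<open>
  A union bound over kernel vectors.  The factor \<open>q - 1\<close> comes from counting each singular matrix
  once for every nonzero multiple of a kernel vector; without it the bound would be trivial for
  square matrices.
\<close>

lemma card_nontrivial_kernel:
  assumes "CARD('n::finite) \<le> CARD('k::finite)"
  shows "(CARD('a::{field,finite}) - 1) * card {A :: 'a ^ 'n ^ 'k. \<exists>x. x \<noteq> 0 \<and> A *v x = 0} \<le> CARD('a ^ 'n ^ 'k)"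
proof -
  define q where "q = CARD('a)"
  have q0: "0 < q" by (simp add: q_def)
  define Z where "Z = {A :: 'a ^ 'n ^ 'k. \<exists>x. x \<noteq> 0 \<and> A *v x = 0}"
  define K where "K A = {x :: 'a ^ 'n. x \<noteq> 0 \<and> A *v x = 0}" for A :: "'a ^ 'n ^ 'k"
  have K: "q - 1 \<le> card (K A)" if "A \<in> Z" for A
  proof -
    have "\<exists>x. x \<noteq> 0 \<and> A *v x = 0" using that by (simp only: Z_def mem_Collect_eq)
    then obtain x where x: "x \<noteq> 0" "A *v x = 0" by (elim exE conjE)
    then obtain j where j: "x $ j \<noteq> 0" by (auto simp: vec_eq_iff)
    have "inj (\<lambda>c. c *s x)"
    proof (rule injI)
      fix c c' assume "c *s x = c' *s x"
      then have "(c *s x) $ j = (c' *s x) $ j" by (rule arg_cong)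
      then show "c = c'" using j x(1) by simp
    qed
    then have "card ((\<lambda>c. c *s x) ` (UNIV - {0})) = card (UNIV - {0 :: 'a})"
      by (intro card_image) (auto simp: inj_on_def)
    also have "\<dots> = q - 1" by (simp add: q_def card_Diff_subset)
    finally have "q - 1 = card ((\<lambda>c. c *s x) ` (UNIV - {0}))" by simp
    also have "\<dots> \<le> card (K A)"
      using x by (intro card_mono) (auto simp: K_def vector_scalar_commute)
    finally show ?thesis .
  qed
  have "q ^ CARD('k) * ((q - 1) * card Z) \<le> q ^ CARD('k) * (\<Sum>A\<in>Z. card (K A))"
    using sum_mono[of Z "\<lambda>_. q - 1" "\<lambda>A. card (K A)"] K by (simp add: mult.commute)
  also have "\<dots> \<le> q ^ CARD('k) * (\<Sum>A\<in>UNIV. card (K A))"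
    by (intro mult_le_mono2 sum_mono2) auto
  also have "(\<Sum>A\<in>UNIV. card (K A)) = (\<Sum>x\<in>UNIV - {0}. card {A :: 'a ^ 'n ^ 'k. A *v x = 0})"
  proof -
    have "card (K A) = (\<Sum>x\<in>UNIV - {0}. of_bool (A *v x = 0))" for A
    proof -
      have "K A = (UNIV - {0}) \<inter> {x. A *v x = 0}" by (auto simp: K_def)
      then show ?thesis by simp
    qed
    then have "(\<Sum>A\<in>UNIV. card (K A)) =
        (\<Sum>A\<in>(UNIV :: ('a ^ 'n ^ 'k) set). \<Sum>x\<in>UNIV - {0}. of_bool (A *v x = 0))"
      by simp
    also have "\<dots> = (\<Sum>x\<in>UNIV - {0}. \<Sum>A\<in>(UNIV :: ('a ^ 'n ^ 'k) set). of_bool (A *v x = 0))" by (rule sum.swap)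
    finally show ?thesis by simp
  qed
  also have "q ^ CARD('k) * \<dots> = (\<Sum>x\<in>UNIV - {0 :: 'a ^ 'n}. CARD('a ^ 'n ^ 'k))"
    unfolding sum_distrib_left q_def
    using mult_card_solutions[where x = "0 :: 'a ^ 'k"] by (intro sum.cong refl) (simp add: mult.commute)
  also have "\<dots> = (q ^ CARD('n) - 1) * CARD('a ^ 'n ^ 'k)" by (simp add: q_def card_Diff_subset)
  also have "\<dots> \<le> q ^ CARD('k) * CARD('a ^ 'n ^ 'k)"
    using power_increasing[OF assms, of q] q0 by (intro mult_le_mono1) simp
  finally show ?thesis using q0 by (simp add: q_def Z_def)
qed

section \<open>A greedy covering argument\<close>

text \<open>
  If every point of \<open>X\<close> lies in a proportion of the sets \<open>Y w\<close>, then three fifths of \<open>X\<close> can be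
  covered at a cost proportional to the ratio of average cost to that proportion.  As long as two
  fifths of \<open>X\<close> are uncovered, the average gain of a further set is large, so some set has cost
  below \<open>K\<close> times its gain.  Choosing a subfamily with cost at most \<open>K\<close> times its coverage and with
  maximal coverage makes the iteration unnecessary.
\<close>

lemma greedy_cover:
  fixes c :: "'w \<Rightarrow> real" and Y :: "'w \<Rightarrow> 'x set"
  assumes "finite \<Omega>" "finite X"
    and hit: "\<And>x. x \<in> X \<Longrightarrow> \<rho> \<le> real (card {w \<in> \<Omega>. x \<in> Y w})"
    and cost: "(\<Sum>w\<in>\<Omega>. c w) \<le> \<kappa>" and nonneg: "\<And>w. 0 \<le> c w"
    and "0 \<le> K" "0 \<le> \<rho>" and slack: "\<kappa> < K * \<rho> * (2 / 5 * real (card X))"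
  shows "\<exists>J\<subseteq>\<Omega>. (\<Sum>w\<in>J. c w) \<le> K * real (card X) \<and> 3 * card X \<le> 5 * card (X \<inter> (\<Union>w\<in>J. Y w))"
proof -
  define U where "U J = X \<inter> (\<Union>w\<in>J. Y w)" for J
  define good where "good J \<longleftrightarrow> J \<subseteq> \<Omega> \<and> (\<Sum>w\<in>J. c w) \<le> K * real (card (U J))" for J
  have finU: "finite (U J)" for J using assms(2) by (simp add: U_def)
  have "good {}" by (simp add: good_def U_def)
  moreover have "finite {J. good J}"
    by (rule finite_subset[of _ "Pow \<Omega>"]) (use assms(1) in \<open>auto simp: good_def\<close>)
  ultimately have "Max ((\<lambda>J. card (U J)) ` {J. good J}) \<in> (\<lambda>J. card (U J)) ` {J. good J}"
    and fin: "finite {J. good J}"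
    by (auto intro!: Max_in)
  then obtain J where J: "good J" and Jmax: "card (U J) = Max ((\<lambda>J. card (U J)) ` {J. good J})" by auto
  have max: "card (U J') \<le> card (U J)" if "good J'" for J'
    unfolding Jmax using fin that by (intro Max_ge) auto
  have "3 * card X \<le> 5 * card (U J)"
  proof (rule ccontr)
    assume "\<not> 3 * card X \<le> 5 * card (U J)"
    then have "5 * card (U J) < 3 * card X" by simp
    moreover have "card (X - U J) = card X - card (U J)"
      using assms(2) by (intro card_Diff_subset finU) (auto simp: U_def)
    moreover have "card (U J) \<le> card X" using assms(2) by (intro card_mono) (auto simp: U_def)
    ultimately have big: "2 / 5 * real (card X) \<le> real (card (X - U J))" by (simp add: of_nat_diff)
    have "(\<Sum>w\<in>\<Omega>. c w) < (\<Sum>w\<in>\<Omega>. K * real (card ((X - U J) \<inter> Y w)))"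
    proof -
      have "(\<Sum>w\<in>\<Omega>. c w) < K * \<rho> * (2 / 5 * real (card X))" using cost slack by simp
      also have "\<dots> \<le> K * \<rho> * real (card (X - U J))"
        using big assms(6,7) by (intro mult_left_mono) auto
      also have "\<dots> = K * (\<Sum>x\<in>X - U J. \<rho>)" by simp
      also have "\<dots> \<le> K * (\<Sum>x\<in>X - U J. real (card {w \<in> \<Omega>. x \<in> Y w}))"
        using assms(6) hit by (intro mult_left_mono sum_mono) auto
      also have "(\<Sum>x\<in>X - U J. real (card {w \<in> \<Omega>. x \<in> Y w})) = (\<Sum>x\<in>X - U J. \<Sum>w\<in>\<Omega>. of_bool (x \<in> Y w))"
        using assms(1) by (intro sum.cong refl) (simp add: Int_def)
      also have "\<dots> = (\<Sum>w\<in>\<Omega>. \<Sum>x\<in>X - U J. of_bool (x \<in> Y w))" by (rule sum.swap)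
      also have "\<dots> = (\<Sum>w\<in>\<Omega>. real (card ((X - U J) \<inter> Y w)))"
        using assms(2) by (intro sum.cong refl) (simp add: Int_def)
      finally show ?thesis by (simp add: sum_distrib_left)
    qed
    then obtain w where w: "w \<in> \<Omega>" "c w < K * real (card ((X - U J) \<inter> Y w))"
      by (meson not_le sum_mono)
    have gain: "0 < card ((X - U J) \<inter> Y w)" using w(2) nonneg[of w] by (cases "card ((X - U J) \<inter> Y w)") auto
    then have "w \<notin> J" using assms(2) by (auto simp: U_def card_gt_0_iff)
    moreover have "finite J" using J assms(1) by (auto simp: good_def intro: finite_subset)
    ultimately have csum: "(\<Sum>w\<in>insert w J. c w) = c w + (\<Sum>w\<in>J. c w)" by simp
    have "U (insert w J) = U J \<union> ((X - U J) \<inter> Y w)" by (auto simp: U_def)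
    then have cU: "card (U (insert w J)) = card (U J) + card ((X - U J) \<inter> Y w)"
      using assms(2) finU[of J] by (simp add: card_Un_disjoint Int_assoc[symmetric])
    have "good (insert w J)"
      using J w csum cU by (simp add: good_def distrib_left)
    then show False using max[of "insert w J"] cU gain by simp
  qed
  moreover have "(\<Sum>w\<in>J. c w) \<le> K * real (card X)"
  proof -
    have "card (U J) \<le> card X" using assms(2) by (intro card_mono) (auto simp: U_def)
    then have "K * real (card (U J)) \<le> K * real (card X)" using assms(6) by (intro mult_left_mono) auto
    then show ?thesis using J by (simp add: good_def)
  qed
  ultimately show ?thesis using J unfolding good_def U_def by blast
qed

section \<open>From an unbalanced map to a rich plane\<close>

text \<open>
  The points of the target whose fibre in \<open>S\<close> is off its expected size by the relative amount
  \<open>\<tau> / 2\<close>.  Taking half of the tolerance leaves room for a second random choice.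
\<close>

definition deviating :: "('a::{field,finite} ^ 'n::finite) set \<Rightarrow> real \<Rightarrow> 'a ^ 'n ^ 'k::finite \<Rightarrow> ('a ^ 'k) set" where
  "deviating S \<tau> M = {x. \<tau> / 2 * mean_fibre TYPE('k) S
      \<le> \<bar>real (card {s \<in> S. M *v s = x}) - mean_fibre TYPE('k) S\<bar>}"

text \<open>
  The pairs are indexed by \<open>bool\<close>, and linear dependence of \<open>v True\<close> and \<open>v False\<close> is not excluded;
  the parametrised plane is then counted with repetitions.
\<close>

definition rich :: "('a::{field,finite} ^ 'm::finite) set \<Rightarrow> (bool \<Rightarrow> 'a ^ 'm) \<Rightarrow> bool" where
  "rich B v \<longleftrightarrow> (\<exists>y. 3 * (CARD('a))\<^sup>2 \<le> 4 * card {s. y + (\<Sum>k\<in>UNIV. s k *s v k) \<in> B})"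

lemma rich_mono: "B \<subseteq> B' \<Longrightarrow> rich B v \<Longrightarrow> rich B' v"
proof -
  assume sub: "B \<subseteq> B'" and "rich B v"
  then obtain y where y: "3 * (CARD('a))\<^sup>2 \<le> 4 * card {s. y + (\<Sum>k\<in>UNIV. s k *s v k) \<in> B}"
    by (auto simp: rich_def)
  have "card {s. y + (\<Sum>k\<in>UNIV. s k *s v k) \<in> B} \<le> card {s. y + (\<Sum>k\<in>UNIV. s k *s v k) \<in> B'}"
    using sub by (intro card_mono) auto
  then have "3 * (CARD('a))\<^sup>2 \<le> 4 * card {s. y + (\<Sum>k\<in>UNIV. s k *s v k) \<in> B'}" using y by linarith
  then show "rich B' v" by (auto simp: rich_def)
qed

lemma card_rich_directions_less:
  fixes B :: "('a::{field,finite} ^ 'm::finite) set"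
  assumes "3 \<le> CARD('m)" "16 * CARD('m) \<le> CARD('a)" "7 * card B \<le> CARD('a) ^ CARD('m)"
  shows "2 * card {v. rich B v} < CARD('a) ^ (2 * CARD('m))"
proof -
  define B' where "B' = ($) ` B"
  define \<phi> where "\<phi> v = (\<lambda>k. ($) (v k))" for v :: "bool \<Rightarrow> 'a ^ 'm"
  define R where "R = {v :: bool \<Rightarrow> 'm \<Rightarrow> 'a. \<exists>y. 3 * (CARD('a))\<^sup>2 \<le>
      4 * card {s. (\<lambda>i. y i + (\<Sum>k\<in>UNIV. s k * v k i)) \<in> B'}}"
  have "card B' \<le> card B" unfolding B'_def by (intro card_image_le) simp
  then have "2 * card R < CARD('a) ^ (2 * CARD('m))"
    unfolding R_def by (intro rank_two_kakeya) (use assms in auto)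
  moreover have "card {v. rich B v} \<le> card R"
  proof (rule card_inj_on_le)
    show "inj_on \<phi> {v. rich B v}" by (rule inj_onI) (auto simp: \<phi>_def fun_eq_iff vec_eq_iff)
    show "\<phi> ` {v. rich B v} \<subseteq> R"
    proof clarify
      fix v assume "rich B v"
      then obtain y where y: "3 * (CARD('a))\<^sup>2 \<le> 4 * card {s. y + (\<Sum>k\<in>UNIV. s k *s v k) \<in> B}"
        by (auto simp: rich_def)
      have "{s. y + (\<Sum>k\<in>UNIV. s k *s v k) \<in> B} = {s. (\<lambda>i. y $ i + (\<Sum>k\<in>UNIV. s k * \<phi> v k i)) \<in> B'}"
      proof -
        have "(\<lambda>i. y $ i + (\<Sum>k\<in>UNIV. s k * \<phi> v k i)) = ($) (y + (\<Sum>k\<in>UNIV. s k *s v k))" for s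
          by (simp add: fun_eq_iff \<phi>_def)
        moreover have "($) x \<in> B' \<longleftrightarrow> x \<in> B" for x
          unfolding B'_def by (auto simp: vec_eq_iff fun_eq_iff image_iff) (metis vec_eq_iff)
        ultimately show ?thesis by simp
      qed
      then show "\<phi> v \<in> R" unfolding R_def using y by auto
    qed
    show "finite R" by simp
  qed
  ultimately show ?thesis by linarith
qed

lemma sum_card_deviating:
  fixes S :: "('a::{field,finite} ^ 'n::finite) set"
  assumes "0 < \<tau>" "0 < \<delta>" "S \<noteq> {}" "192 \<le> \<tau>\<^sup>2 * \<delta> * mean_fibre TYPE('k::finite) S"
  shows "(\<Sum>M\<in>UNIV. real (card (deviating S \<tau> (M :: 'a ^ 'n ^ 'k))))
    \<le> \<delta> / 48 * real (CARD('a) ^ CARD('k)) * real CARD('a ^ 'n ^ 'k)"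
proof -
  define \<nu> where "\<nu> = mean_fibre TYPE('k) S"
  define Q where "Q = real (CARD('a) ^ CARD('k))"
  define N where "N = real CARD('a ^ 'n ^ 'k)"
  have Q0: "0 < Q" by (simp add: Q_def)
  have S0: "0 < real (card S)" using assms(3) by (simp add: card_gt_0_iff)
  have \<nu>: "\<nu> = real (card S) / Q" by (simp add: \<nu>_def Q_def mean_fibre_def)
  have \<nu>0: "0 < \<nu>" using Q0 S0 by (simp add: \<nu>)
  define g where "g = \<tau> / 2 * \<nu>"
  have g0: "0 < g" using assms(1) \<nu>0 by (simp add: g_def)
  have "(\<Sum>M\<in>UNIV. real (card (deviating S \<tau> (M :: 'a ^ 'n ^ 'k)))) * g\<^sup>2 =
      (\<Sum>M\<in>UNIV. \<Sum>x\<in>deviating S \<tau> (M :: 'a ^ 'n ^ 'k). g\<^sup>2)"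
    by (simp add: sum_distrib_right)
  also have "\<dots> \<le> (\<Sum>M\<in>UNIV. \<Sum>x\<in>deviating S \<tau> (M :: 'a ^ 'n ^ 'k). (real (card {s \<in> S. M *v s = x}) - \<nu>)\<^sup>2)"
  proof (intro sum_mono)
    fix M :: "'a ^ 'n ^ 'k" and x assume "x \<in> deviating S \<tau> M"
    then have "g \<le> \<bar>real (card {s \<in> S. M *v s = x}) - \<nu>\<bar>" by (simp add: deviating_def g_def \<nu>_def)
    then show "g\<^sup>2 \<le> (real (card {s \<in> S. M *v s = x}) - \<nu>)\<^sup>2"
      using g0 by (simp flip: abs_le_square_iff)
  qed
  also have "\<dots> \<le> (\<Sum>M\<in>UNIV. \<Sum>x\<in>UNIV. (real (card {s \<in> S. (M :: 'a ^ 'n ^ 'k) *v s = x}) - \<nu>)\<^sup>2)"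
    by (intro sum_mono sum_mono2) auto
  also have "\<dots> \<le> \<nu> * Q * N"
    using second_moment[where 'k = 'k, of S] Q0 by (simp add: \<nu> Q_def N_def)
  also have "\<dots> \<le> (\<delta> / 48 * Q * N) * g\<^sup>2"
  proof -
    have "192 * \<nu> \<le> \<tau>\<^sup>2 * \<delta> * \<nu> * \<nu>" using assms(4) \<nu>0 by (simp add: \<nu>_def)
    then have "\<nu> \<le> \<delta> / 48 * g\<^sup>2" by (simp add: g_def power_mult_distrib power2_eq_square field_simps)
    then have "\<nu> * (Q * N) \<le> (\<delta> / 48 * g\<^sup>2) * (Q * N)" using Q0 by (intro mult_right_mono) (auto simp: N_def)
    then show ?thesis by (simp add: mult_ac)
  qed
  finally show ?thesis using g0 by (simp add: Q_def N_def)
qed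

text \<open>
  A matrix with \<open>b + 2\<close> rows is split into its first \<open>b\<close> rows and the last two; since a matrix is
  a vector of rows, the same function joins vectors and stacks matrices.
\<close>

definition join :: "'a ^ 'b::finite \<Rightarrow> 'a ^ bool \<Rightarrow> 'a ^ ('b + bool)" where
  "join y z = (\<chi> r. case r of Inl i \<Rightarrow> y $ i | Inr j \<Rightarrow> z $ j)"

definition stack :: "'a ^ 'n ^ 'b::finite \<Rightarrow> 'a ^ 'n ^ bool \<Rightarrow> 'a ^ 'n ^ ('b + bool)" where
  "stack = join"

lemma join_eq_iff: "join y z = join y' z' \<longleftrightarrow> y = y' \<and> z = z'"
  by (auto simp: join_def vec_eq_iff split: sum.splits)

lemma stack_mult: "stack L R *v s = join (L *v s) (R *v s)"
  by (auto simp: stack_def join_def vec_eq_iff matrix_vector_mult_def split: sum.splits)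

text \<open>
  With \<open>\<nu>\<close> the expected fibre size and \<open>a\<close> the average fibre size on an unbalanced plane, \<open>g\<close> is a
  lower bound for the distance from \<open>a\<close> to the size of a fibre that does not deviate.  The term \<open>8 * a\<close> is what the
  second moment bound requires in order to make such fibres rare.
\<close>

lemma gap_inequality:
  fixes a \<nu> \<tau> g :: real
  assumes "0 < \<tau>" "\<tau> \<le> 1" "192 \<le> \<tau>\<^sup>2 * \<nu>" "0 \<le> a" "\<tau> * \<nu> < \<bar>a - \<nu>\<bar>"
    and g: "g = \<bar>a - \<nu>\<bar> - \<tau> / 2 * \<nu>"
  shows "0 < g \<and> 8 * a \<le> g\<^sup>2"
proof -
  have \<nu>0: "0 < \<nu>" using assms(1,3) by (smt (verit) mult_nonneg_nonpos zero_le_power2)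
  have tn: "\<tau>\<^sup>2 * \<nu> \<le> \<tau> * \<nu>" using assms(1,2) \<nu>0 by (simp add: power2_eq_square mult_le_one)
  have g1: "\<tau> * \<nu> / 2 < g"
  proof -
    have "\<tau> / 2 * \<nu> = \<tau> * \<nu> / 2" by simp
    then show ?thesis using assms(5) g by linarith
  qed
  have g0: "0 < g" using g1 assms(1) \<nu>0 by (smt (verit) divide_pos_pos mult_pos_pos)
  have "(\<tau> * \<nu> / 2)\<^sup>2 \<le> g\<^sup>2" using g1 assms(1) \<nu>0 by (intro power_mono) auto
  then have "\<tau>\<^sup>2 * \<nu> * \<nu> \<le> 4 * g\<^sup>2" by (simp add: power2_eq_square field_simps)
  moreover have "192 * \<nu> \<le> \<tau>\<^sup>2 * \<nu> * \<nu>" using assms(3) \<nu>0 by simp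
  ultimately have G: "48 * \<nu> \<le> g\<^sup>2" by simp
  have "96 \<le> g" using assms(3) tn g1 by simp
  then have G2: "96 * g \<le> g\<^sup>2" using g0 by (simp add: power2_eq_square)
  have "\<tau> * \<nu> \<le> \<nu>" using assms(2) \<nu>0 by simp
  then have "a \<le> \<nu> + \<nu> / 2 + g" using g by (auto simp: abs_if split: if_splits)
  then show ?thesis using G G2 g0 by simp
qed

text \<open>
  Let the fibre \<open>T\<close> of \<open>L\<close> over \<open>y\<close> be too large or too small.  Two further random rows distribute
  \<open>T\<close> over the plane of all points \<open>join y z\<close>, and by the second moment bound, applied to \<open>T\<close>, they do
  so almost evenly.  Hence most points of this plane inherit the deviation of \<open>T\<close>.  The same
  argument serves the upper and the lower tail, and no union bound over \<open>y\<close> is needed because only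
  one bad \<open>y\<close> is used.
\<close>

lemma unbalanced_extension:
  fixes S :: "('a::{field,finite} ^ 'n::finite) set" and L :: "'a ^ 'n ^ 'b::finite"
  assumes \<tau>: "0 < \<tau>" "\<tau> \<le> 1" and large: "192 \<le> \<tau>\<^sup>2 * mean_fibre TYPE('b + bool) S"
    and unb: "\<not> balanced S \<tau> ((*v) L)"
  shows "CARD('a ^ 'n ^ bool) \<le> 2 * card {R :: 'a ^ 'n ^ bool. \<exists>y.
    3 * (CARD('a))\<^sup>2 \<le> 4 * card {z. join y z \<in> deviating S \<tau> (stack L R)}}"
proof -
  define q where "q = real CARD('a)"
  have q0: "0 < q" by (simp add: q_def)
  define \<nu> where "\<nu> = mean_fibre TYPE('b + bool) S"
  have \<mu>: "mean_fibre TYPE('b) S = \<nu> * q\<^sup>2"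
    using q0 by (simp add: \<nu>_def mean_fibre_def q_def field_simps power2_eq_square)
  obtain y where y: "real (card (S \<inter> (*v) L -` {y})) < (1 - \<tau>) * (\<nu> * q\<^sup>2) \<or>
      (1 + \<tau>) * (\<nu> * q\<^sup>2) < real (card (S \<inter> (*v) L -` {y}))"
    using unb unfolding balanced_def \<mu> by (auto simp: not_le)
  define T where "T = S \<inter> (*v) L -` {y}"
  define a where "a = real (card T) / q\<^sup>2"
  have ya: "a < (1 - \<tau>) * \<nu> \<or> (1 + \<tau>) * \<nu> < a"
    using y q0 by (simp add: a_def T_def field_simps)
  define g where "g = \<bar>a - \<nu>\<bar> - \<tau> / 2 * \<nu>"
  have g: "0 < g \<and> 8 * a \<le> g\<^sup>2"
  proof (rule gap_inequality[OF \<tau>])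
    show "192 \<le> \<tau>\<^sup>2 * \<nu>" using large by (simp add: \<nu>_def)
    show "\<tau> * \<nu> < \<bar>a - \<nu>\<bar>" using ya by (auto simp: algebra_simps)
  qed (auto simp: a_def g_def)
  define U where "U R = {z. join y z \<notin> deviating S \<tau> (stack L R)}" for R
  define N where "N = real CARD('a ^ 'n ^ bool)"
  have wT: "card {s \<in> S. stack L R *v s = join y z} = card {s \<in> T. R *v s = z}" for R z
    by (rule arg_cong[of _ _ card]) (auto simp: stack_mult join_eq_iff T_def)
  have "(\<Sum>R\<in>UNIV. real (card (U R))) * g\<^sup>2 = (\<Sum>R\<in>UNIV. \<Sum>z\<in>U R. g\<^sup>2)"
    by (simp add: sum_distrib_right)
  also have "\<dots> \<le> (\<Sum>R\<in>UNIV. \<Sum>z\<in>U R. (real (card {s \<in> T. R *v s = z}) - a)\<^sup>2)"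
  proof (intro sum_mono)
    fix R z assume "z \<in> U R"
    then have "\<bar>real (card {s \<in> T. R *v s = z}) - \<nu>\<bar> < \<tau> / 2 * \<nu>"
      by (simp add: U_def deviating_def wT \<nu>_def)
    then have "g \<le> \<bar>real (card {s \<in> T. R *v s = z}) - a\<bar>" unfolding g_def by linarith
    then show "g\<^sup>2 \<le> (real (card {s \<in> T. R *v s = z}) - a)\<^sup>2"
      using g by (simp flip: abs_le_square_iff)
  qed
  also have "\<dots> \<le> (\<Sum>R\<in>UNIV. \<Sum>z\<in>UNIV. (real (card {s \<in> T. (R :: 'a ^ 'n ^ bool) *v s = z}) - a)\<^sup>2)"
    by (intro sum_mono sum_mono2) auto
  also have "\<dots> \<le> a * q\<^sup>2 * N"
    using second_moment[where 'k = bool, of T] q0 by (simp add: a_def q_def N_def)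
  also have "\<dots> \<le> (q\<^sup>2 * N / 8) * g\<^sup>2"
  proof -
    have "(8 * a) * (q\<^sup>2 * N) \<le> g\<^sup>2 * (q\<^sup>2 * N)" using g by (intro mult_right_mono) (auto simp: N_def)
    then show ?thesis by (simp add: mult_ac)
  qed
  finally have avg: "(\<Sum>R\<in>UNIV. real (card (U R))) \<le> q\<^sup>2 * N / 8" using g by simp
  define Bad where "Bad = {R :: 'a ^ 'n ^ bool. q\<^sup>2 < 4 * real (card (U R))}"
  have "q\<^sup>2 / 4 * real (card Bad) = (\<Sum>R\<in>Bad. q\<^sup>2 / 4)" by simp
  also have "\<dots> \<le> (\<Sum>R\<in>Bad. real (card (U R)))" by (intro sum_mono) (auto simp: Bad_def)
  also have "\<dots> \<le> (\<Sum>R\<in>UNIV. real (card (U R)))" by (intro sum_mono2) auto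
  also have "\<dots> \<le> q\<^sup>2 / 4 * (N / 2)" using avg by simp
  finally have bad: "real (card Bad) \<le> N / 2" using q0 by (simp add: field_simps)
  have sub: "- Bad \<subseteq> {R. \<exists>y. 3 * (CARD('a))\<^sup>2 \<le> 4 * card {z. join y z \<in> deviating S \<tau> (stack L R)}}"
  proof (clarify)
    fix R assume R: "R \<notin> Bad"
    have "{z. join y z \<in> deviating S \<tau> (stack L R)} = UNIV - U R" by (auto simp: U_def)
    then have "card {z. join y z \<in> deviating S \<tau> (stack L R)} = (CARD('a))\<^sup>2 - card (U R)"
      by (simp add: card_Diff_subset)
    moreover have "4 * card (U R) \<le> (CARD('a))\<^sup>2"
    proof -
      have "real (4 * card (U R)) \<le> real ((CARD('a))\<^sup>2)" using R by (simp add: Bad_def q_def not_less)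
      then show ?thesis by (simp only: of_nat_le_iff)
    qed
    ultimately have "3 * (CARD('a))\<^sup>2 \<le> 4 * card {z. join y z \<in> deviating S \<tau> (stack L R)}" by linarith
    then show "\<exists>y. 3 * (CARD('a))\<^sup>2 \<le> 4 * card {z. join y z \<in> deviating S \<tau> (stack L R)}" by blast
  qed
  have "card (- Bad) = CARD('a ^ 'n ^ bool) - card Bad"
    by (simp only: Compl_eq_Diff_UNIV) (subst card_Diff_subset, auto)
  moreover have "real (2 * card Bad) \<le> real CARD('a ^ 'n ^ bool)" using bad by (simp add: N_def)
  then have "2 * card Bad \<le> CARD('a ^ 'n ^ bool)" by (simp only: of_nat_le_iff)
  ultimately have "CARD('a ^ 'n ^ bool) \<le> 2 * card (- Bad)" by linarith
  also have "\<dots> \<le> 2 * card {R :: 'a ^ 'n ^ bool. \<exists>y.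
      3 * (CARD('a))\<^sup>2 \<le> 4 * card {z. join y z \<in> deviating S \<tau> (stack L R)}}"
    using sub by (intro mult_le_mono2 card_mono) auto
  finally show ?thesis .
qed

lemma deviating_mult_left:
  fixes g :: "'a::{field,finite} ^ 'm::finite ^ 'm" and M :: "'a ^ 'n::finite ^ 'm"
  assumes "inj ((*v) g)"
  shows "g *v x \<in> deviating S \<tau> (g ** M) \<longleftrightarrow> x \<in> deviating S \<tau> M"
proof -
  have "{s \<in> S. (g ** M) *v s = g *v x} = {s \<in> S. M *v s = x}"
    using injD[OF assms] by (auto simp flip: matrix_vector_mul_assoc)
  then show ?thesis by (simp add: deviating_def)
qed

lemma join_axes:
  fixes y :: "'a::{field,finite} ^ 'b::finite"
  shows "join y (\<chi> k. s k) = join y 0 + (\<Sum>k\<in>UNIV. s k *s axis (Inr k) 1)"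
proof -
  have "join y (\<chi> k. s k) $ r = (join y 0 + (\<Sum>k\<in>UNIV. s k *s axis (Inr k) 1)) $ r" for r
  proof (cases r)
    case (Inr k)
    have "(\<Sum>j\<in>UNIV. s j * axis (Inr j :: 'b + bool) (1 :: 'a) $ Inr k) = (\<Sum>j\<in>UNIV. if j = k then s j else 0)"
      by (intro sum.cong) (auto simp: axis_def)
    then show ?thesis using Inr by (simp add: join_def)
  qed (simp add: join_def axis_def)
  then show ?thesis by (simp add: vec_eq_iff)
qed

text \<open>
  The previous lemma speaks of the coordinate direction \<open>axis (Inr k)\<close>; multiplication by an
  invertible \<open>g\<close> permutes the matrices \<open>M\<close> and carries this direction to any other one.  So each
  direction separately is rich for a random \<open>M\<close> with at least half the probability that \<open>L\<close> is
  unbalanced.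
\<close>

lemma rich_direction_count:
  fixes S :: "('a::{field,finite} ^ 'n::finite) set" and g :: "'a ^ ('b::finite + bool) ^ ('b + bool)"
  assumes \<tau>: "0 < \<tau>" "\<tau> \<le> 1" and large: "192 \<le> \<tau>\<^sup>2 * mean_fibre TYPE('b + bool) S"
    and inj: "inj ((*v) g)"
  shows "card {L :: 'a ^ 'n ^ 'b. \<not> balanced S \<tau> ((*v) L)} * CARD('a ^ 'n ^ bool)
    \<le> 2 * card {M. rich (deviating S \<tau> (M :: 'a ^ 'n ^ ('b + bool))) (\<lambda>k. g *v axis (Inr k) 1)}"
proof -
  define G where "G L = {R :: 'a ^ 'n ^ bool. \<exists>y.
    3 * (CARD('a))\<^sup>2 \<le> 4 * card {z. join y z \<in> deviating S \<tau> (stack L R)}}" for L :: "'a ^ 'n ^ 'b"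
  define Unb where "Unb = {L :: 'a ^ 'n ^ 'b. \<not> balanced S \<tau> ((*v) L)}"
  define f where "f = (\<lambda>(L, R). g ** stack L R :: 'a ^ 'n ^ ('b + bool))"
  have "card Unb * CARD('a ^ 'n ^ bool) = (\<Sum>L\<in>Unb. CARD('a ^ 'n ^ bool))" by simp
  also have "\<dots> \<le> (\<Sum>L\<in>Unb. 2 * card (G L))"
    unfolding G_def by (intro sum_mono unbalanced_extension[OF \<tau> large]) (simp add: Unb_def)
  also have "\<dots> = 2 * card (SIGMA L:Unb. G L)" by (simp add: sum_distrib_left)
  also have "\<dots> \<le> 2 * card {M. rich (deviating S \<tau> (M :: 'a ^ 'n ^ ('b + bool))) (\<lambda>k. g *v axis (Inr k) 1)}"
  proof (intro mult_le_mono2 card_inj_on_le)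
    show "inj_on f (SIGMA L:Unb. G L)"
    proof (rule inj_onI, clarify)
      fix L R L' R' assume "f (L, R) = f (L', R')"
      then have "g *v (stack L R *v s) = g *v (stack L' R' *v s)" for s
        by (simp add: f_def matrix_vector_mul_assoc)
      then have "stack L R *v s = stack L' R' *v s" for s using injD[OF inj] by blast
      then have "stack L R = stack L' R'" by (simp add: matrix_eq)
      then show "L = L' \<and> R = R'" by (simp add: stack_def join_eq_iff)
    qed
    show "f ` (SIGMA L:Unb. G L) \<subseteq> {M. rich (deviating S \<tau> M) (\<lambda>k. g *v axis (Inr k) 1)}"
    proof clarify
      fix L R assume "R \<in> G L"
      then obtain y where y: "3 * (CARD('a))\<^sup>2 \<le> 4 * card {z. join y z \<in> deviating S \<tau> (stack L R)}"
        by (auto simp: G_def)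
      have pt: "g *v join y 0 + (\<Sum>k\<in>UNIV. s k *s (g *v axis (Inr k) 1)) = g *v join y (\<chi> k. s k)" for s
        unfolding join_axes by (simp add: matrix_vector_right_distrib UNIV_bool vector_scalar_commute)
      have "card {z. join y z \<in> deviating S \<tau> (stack L R)} \<le>
          card {s. g *v join y 0 + (\<Sum>k\<in>UNIV. s k *s (g *v axis (Inr k) 1)) \<in> deviating S \<tau> (f (L, R))}"
      proof (rule card_inj_on_le[where f = "($)"])
        show "inj_on ($) {z. join y z \<in> deviating S \<tau> (stack L R)}" by (rule inj_onI) (simp add: vec_eq_iff)
        show "($) ` {z. join y z \<in> deviating S \<tau> (stack L R)} \<subseteq>
          {s. g *v join y 0 + (\<Sum>k\<in>UNIV. s k *s (g *v axis (Inr k) 1)) \<in> deviating S \<tau> (f (L, R))}"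
          by (auto simp: pt f_def deviating_mult_left[OF inj])
      qed simp
      then have "3 * (CARD('a))\<^sup>2 \<le> 4 * card {s. g *v join y 0 + (\<Sum>k\<in>UNIV. s k *s (g *v axis (Inr k) 1)) \<in> deviating S \<tau> (f (L, R))}"
        using y by linarith
      then show "rich (deviating S \<tau> (f (L, R))) (\<lambda>k. g *v axis (Inr k) 1)" unfolding rich_def by blast
    qed
  qed simp
  finally show ?thesis by (simp add: Unb_def)
qed

section \<open>Most linear maps are balanced\<close>

lemma inj_mult_iff: "inj ((*v) (A :: 'a::{field,finite} ^ 'n::finite ^ 'k::finite)) \<longleftrightarrow> (\<forall>x. A *v x = 0 \<longrightarrow> x = 0)"
proof
  assume inj: "inj ((*v) A)"
  show "\<forall>x. A *v x = 0 \<longrightarrow> x = 0"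
  proof (intro allI impI)
    fix x assume "A *v x = 0"
    then have "A *v x = A *v 0" by simp
    then show "x = 0" by (rule injD[OF inj])
  qed
next
  assume ker: "\<forall>x. A *v x = 0 \<longrightarrow> x = 0"
  show "inj ((*v) A)"
  proof (rule injI)
    fix x y assume "A *v x = A *v y"
    then have "A *v (x - y) = 0" by (simp add: matrix_vector_mult_diff_distrib)
    then show "x = y" using ker by force
  qed
qed

lemma card_injective_matrices:
  assumes "CARD('n::finite) \<le> CARD('k::finite)"
  shows "(CARD('a::{field,finite}) - 1) * (CARD('a ^ 'n ^ 'k) - card {A :: 'a ^ 'n ^ 'k. inj ((*v) A)}) \<le> CARD('a ^ 'n ^ 'k)"
proof -
  have "{A :: 'a ^ 'n ^ 'k. \<exists>x. x \<noteq> 0 \<and> A *v x = 0} = UNIV - {A. inj ((*v) A)}"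
    by (auto simp: inj_mult_iff)
  then have "card {A :: 'a ^ 'n ^ 'k. \<exists>x. x \<noteq> 0 \<and> A *v x = 0} = CARD('a ^ 'n ^ 'k) - card {A :: 'a ^ 'n ^ 'k. inj ((*v) A)}"
    by (simp only: card_Diff_subset[OF finite subset_UNIV])
  then show ?thesis using card_nontrivial_kernel[OF assms, where 'a = 'a] by (simp only:)
qed

lemma inj_matrix_columns:
  fixes g h :: "'a::{field,finite} ^ 'n::finite ^ 'k::finite"
  assumes "\<And>j. g *v axis j 1 = h *v axis j 1"
  shows "g = h"
proof -
  have "(A *v axis j 1) $ i = A $ i $ j" for A :: "'a ^ 'n ^ 'k" and i j
  proof -
    have "(A *v axis j 1) $ i = (\<Sum>c\<in>UNIV. A $ i $ c * (if c = j then 1 else 0))"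
      by (simp add: matrix_vector_mult_def axis_def)
    also have "\<dots> = (\<Sum>c\<in>UNIV. if c = j then A $ i $ c else 0)" by (intro sum.cong refl) simp
    finally show ?thesis by simp
  qed
  then show ?thesis using assms by (metis vec_eq_iff)
qed

text \<open>
  Suppose that more than a proportion \<open>35/48 \<delta>\<close> of the maps is unbalanced.  Then every
  direction is rich for at least \<open>35/96 \<delta>\<close> of the matrices \<open>M\<close>, whereas the deviating sets have
  average density at most \<open>\<delta>/48\<close>.  The greedy covering produces a union of deviating sets of
  density at most \<open>1/7\<close> that is rich for three fifths of all bases \<open>g\<close>, hence for more than half of
  all pairs of vectors, which is impossible.  Passing to a union is what turns the small
  probabilities, of order \<open>\<delta>\<close>, into the constant ones of the Kakeya bound.
\<close>

lemma few_unbalanced_matrices: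
  fixes S :: "('a::{field,finite} ^ 'n::finite) set"
  assumes "S \<noteq> {}" and \<tau>: "0 < \<tau>" "\<tau> \<le> 1" and \<delta>: "0 < \<delta>" "\<delta> < 1"
    and q: "16 * (CARD('b::finite) + 2) \<le> CARD('a)"
    and large: "192 \<le> \<tau>\<^sup>2 * \<delta> * mean_fibre TYPE('b + bool) S"
  shows "48 * real (card {L :: 'a ^ 'n ^ 'b. \<not> balanced S \<tau> ((*v) L)}) \<le> 35 * \<delta> * real CARD('a ^ 'n ^ 'b)"
proof (rule ccontr)
  define u where "u = card {L :: 'a ^ 'n ^ 'b. \<not> balanced S \<tau> ((*v) L)}"
  define NL where "NL = CARD('a ^ 'n ^ 'b)"
  define NR where "NR = CARD('a ^ 'n ^ bool)"
  define m where "m = CARD('b + bool)"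
  define Q where "Q = CARD('a) ^ m"
  define X where "X = {g :: 'a ^ ('b + bool) ^ ('b + bool). inj ((*v) g)}"
  define V where "V g = (\<lambda>k. g *v axis (Inr k) 1)" for g :: "'a ^ ('b + bool) ^ ('b + bool)"
  define Y where "Y M = {g. rich (deviating S \<tau> (M :: 'a ^ 'n ^ ('b + bool))) (V g)}" for M
  assume "\<not> 48 * real (card {L :: 'a ^ 'n ^ 'b. \<not> balanced S \<tau> ((*v) L)}) \<le> 35 * \<delta> * real CARD('a ^ 'n ^ 'b)"
  then have u: "35 * \<delta> * real NL < 48 * real u" by (simp only: u_def NL_def not_le)
  have m: "m = CARD('b) + 2" by (simp add: m_def)
  have NM: "CARD('a ^ 'n ^ ('b + bool)) = NL * NR" by (simp add: NL_def NR_def power_add power2_eq_square)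
  have pos: "0 < Q" "0 < NL" "0 < NR" by (simp_all add: Q_def NL_def NR_def)
  have "mat 1 \<in> X" by (simp add: X_def inj_mult_iff)
  then have Xne: "X \<noteq> {}" by blast
  then have X0: "0 < card X" by (simp add: card_gt_0_iff)
  have nu0: "0 \<le> mean_fibre TYPE('b + bool) S" by (simp add: mean_fibre_def)
  have large': "192 \<le> \<tau>\<^sup>2 * mean_fibre TYPE('b + bool) S"
  proof -
    have "\<tau>\<^sup>2 * \<delta> * mean_fibre TYPE('b + bool) S \<le> \<tau>\<^sup>2 * 1 * mean_fibre TYPE('b + bool) S"
      using \<delta> nu0 by (intro mult_right_mono mult_left_mono) auto
    then show ?thesis using large by simp
  qed
  \<comment> \<open>The cost per point of \<open>X\<close> is chosen so that covering all of \<open>X\<close> costs density \<open>1/7\<close>.\<close>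
  have "\<exists>J\<subseteq>UNIV. (\<Sum>M\<in>J. real (card (deviating S \<tau> (M :: 'a ^ 'n ^ ('b + bool))))) \<le> real Q / (7 * real (card X)) * real (card X) \<and>
      3 * card X \<le> 5 * card (X \<inter> (\<Union>M\<in>J. Y M))"
  proof (rule greedy_cover[where \<rho> = "real u * real NR / 2" and \<kappa> = "\<delta> / 48 * real Q * real (NL * NR)"])
    fix g assume "g \<in> X"
    then have "u * NR \<le> 2 * card {M \<in> UNIV. g \<in> Y M}"
      using rich_direction_count[OF \<tau> large', of g] by (simp add: X_def Y_def V_def[abs_def] u_def NR_def)
    then have "real (u * NR) \<le> real (2 * card {M \<in> UNIV. g \<in> Y M})" by (simp only: of_nat_le_iff)
    then show "real u * real NR / 2 \<le> real (card {M \<in> UNIV. g \<in> Y M})" by simp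
  next
    show "(\<Sum>M\<in>UNIV. real (card (deviating S \<tau> (M :: 'a ^ 'n ^ ('b + bool))))) \<le> \<delta> / 48 * real Q * real (NL * NR)"
      using sum_card_deviating[OF \<tau>(1) \<delta>(1) assms(1) large] by (simp only: Q_def m_def NM)
  next
    have "\<delta> / 48 * real Q * real (NL * NR) = (35 * \<delta> * real NL) * (real Q * real NR / 1680)" by simp
    also have "\<dots> < (48 * real u) * (real Q * real NR / 1680)"
      using u pos by (intro mult_strict_right_mono) auto
    also have "\<dots> = real Q / (7 * real (card X)) * (real u * real NR / 2) * (2 / 5 * real (card X))"
    proof -
      have "(48 * real u) * (real Q * real NR / 1680) =
          real Q / (7 * x) * (real u * real NR / 2) * (2 / 5 * x)" if "x \<noteq> 0" for x :: real
        using that by (simp add: field_simps)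
      then show ?thesis using X0 by (metis less_numeral_extra(3) of_nat_eq_0_iff)
    qed
    finally show "\<delta> / 48 * real Q * real (NL * NR) <
        real Q / (7 * real (card X)) * (real u * real NR / 2) * (2 / 5 * real (card X))" .
  qed (auto simp: X_def)
  then obtain J where J: "(\<Sum>M\<in>J. real (card (deviating S \<tau> (M :: 'a ^ 'n ^ ('b + bool))))) \<le> real Q / 7"
    "3 * card X \<le> 5 * card (X \<inter> (\<Union>M\<in>J. Y M))" using Xne by auto
  define B where "B = (\<Union>M\<in>J. deviating S \<tau> M)"
  have "card B \<le> (\<Sum>M\<in>J. card (deviating S \<tau> M))" unfolding B_def by (intro card_UN_le) simp
  then have "real (card B) \<le> (\<Sum>M\<in>J. real (card (deviating S \<tau> M)))" by (simp flip: of_nat_sum)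
  then have "real (7 * card B) \<le> real Q" using J(1) by simp
  then have cB: "7 * card B \<le> CARD('a) ^ CARD('b + bool)" by (simp only: of_nat_le_iff Q_def m_def)
  define R where "R = {v. rich B v}"
  have R: "2 * card R < CARD('a) ^ (2 * m)"
    unfolding R_def m_def by (rule card_rich_directions_less[OF _ _ cB]) (use q in auto)
  \<comment> \<open>A basis \<open>g\<close> is determined by its pair \<open>V g\<close> together with its other \<open>b\<close> columns.\<close>
  have "card (X \<inter> (\<Union>M\<in>J. Y M)) \<le> card (R \<times> (UNIV :: ('b \<Rightarrow> 'a ^ ('b + bool)) set))"
  proof (rule card_inj_on_le[where f = "\<lambda>g. (V g, \<lambda>i. g *v axis (Inl i) 1)"])
    show "inj_on (\<lambda>g. (V g, \<lambda>i. g *v axis (Inl i) 1)) (X \<inter> (\<Union>M\<in>J. Y M))"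
    proof (rule inj_onI)
      fix g h assume "(V g, \<lambda>i. g *v axis (Inl i) 1) = (V h, \<lambda>i. h *v axis (Inl i) 1)"
      then have "g *v axis (Inl i) 1 = h *v axis (Inl i) 1" "g *v axis (Inr k) 1 = h *v axis (Inr k) 1" for i k
        by (auto simp: V_def fun_eq_iff)
      then have "g *v axis j 1 = h *v axis j 1" for j by (cases j) auto
      then show "g = h" by (rule inj_matrix_columns)
    qed
    show "(\<lambda>g. (V g, \<lambda>i. g *v axis (Inl i) 1)) ` (X \<inter> (\<Union>M\<in>J. Y M)) \<subseteq> R \<times> UNIV"
    proof (rule image_subsetI)
      fix g assume "g \<in> X \<inter> (\<Union>M\<in>J. Y M)"
      then obtain M where "M \<in> J" "g \<in> Y M" by blast
      then show "(V g, \<lambda>i. g *v axis (Inl i) 1) \<in> R \<times> UNIV"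
        using rich_mono[of "deviating S \<tau> M" B "V g"] by (auto simp: R_def Y_def B_def)
    qed
  qed simp
  also have "\<dots> = card R * (CARD('a) ^ m) ^ CARD('b)"
    by (simp add: card_cartesian_product card_fun m_def)
  finally have "6 * card X \<le> 5 * ((2 * card R) * (CARD('a) ^ m) ^ CARD('b))" using J(2) by simp
  also have "\<dots> < 5 * (CARD('a) ^ (2 * m) * (CARD('a) ^ m) ^ CARD('b))" using R by simp
  also have "CARD('a) ^ (2 * m) * (CARD('a) ^ m) ^ CARD('b) = CARD('a ^ ('b + bool) ^ ('b + bool))"
  proof -
    have "CARD('a) ^ (2 * m) * (CARD('a) ^ m) ^ CARD('b) = (CARD('a) ^ m) ^ (CARD('b) + 2)"
      unfolding power_even_eq power_add by (rule mult.commute)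
    then show ?thesis by (simp add: m)
  qed
  finally have lt: "6 * card X < 5 * CARD('a ^ ('b + bool) ^ ('b + bool))" .
  define NX where "NX = CARD('a ^ ('b + bool) ^ ('b + bool))"
  have "(CARD('a) - 1) * (NX - card X) \<le> NX"
    using card_injective_matrices[where 'a = 'a and 'n = "'b + bool" and 'k = "'b + bool"]
    unfolding NX_def X_def by simp
  moreover have "6 * (NX - card X) \<le> (CARD('a) - 1) * (NX - card X)" using q by (intro mult_le_mono1) simp
  ultimately have "6 * (NX - card X) \<le> NX" by linarith
  then show False using lt unfolding NX_def[symmetric] by linarith
qed

section \<open>Surjections and the final estimate\<close>

lemma surj_transpose_of_inj:
  fixes A :: "'a::{field,finite} ^ 'b::finite ^ 'n::finite"
  assumes "inj ((*v) A)"
  shows "surj ((*v) (transpose A))"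
proof -
  obtain B where "B ** A = mat 1" using assms matrix_left_invertible_injective by blast
  then have "transpose A ** transpose B = mat 1" by (simp flip: matrix_transpose_mul)
  then show ?thesis using matrix_right_invertible_surjective by blast
qed

lemma card_surjective_matrices:
  assumes "CARD('b::finite) \<le> CARD('n::finite)"
  shows "(CARD('a::{field,finite}) - 1) * (CARD('a ^ 'n ^ 'b) - card {A :: 'a ^ 'n ^ 'b. surj ((*v) A)}) \<le> CARD('a ^ 'n ^ 'b)"
proof -
  have eq: "CARD('a ^ 'n ^ 'b) = CARD('a ^ 'b ^ 'n)" by (simp add: mult.commute flip: power_mult)
  have "card {A :: 'a ^ 'b ^ 'n. inj ((*v) A)} \<le> card {A :: 'a ^ 'n ^ 'b. surj ((*v) A)}"
    by (rule card_inj_on_le[where f = transpose])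
      (auto intro!: inj_onI surj_transpose_of_inj dest: arg_cong[where f = transpose])
  then have "CARD('a ^ 'n ^ 'b) - card {A :: 'a ^ 'n ^ 'b. surj ((*v) A)} \<le> CARD('a ^ 'b ^ 'n) - card {A :: 'a ^ 'b ^ 'n. inj ((*v) A)}"
    unfolding eq by (rule diff_le_mono2)
  then have "(CARD('a) - 1) * (CARD('a ^ 'n ^ 'b) - card {A :: 'a ^ 'n ^ 'b. surj ((*v) A)}) \<le>
      (CARD('a) - 1) * (CARD('a ^ 'b ^ 'n) - card {A :: 'a ^ 'b ^ 'n. inj ((*v) A)})" by (rule mult_le_mono2)
  also have "\<dots> \<le> CARD('a ^ 'b ^ 'n)" by (rule card_injective_matrices[OF assms])
  finally show ?thesis unfolding eq .
qed

lemma linear_surjections_eq: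
  "(linear_surjections :: ('a::{field,finite} ^ 'n::finite \<Rightarrow> 'a ^ 'b::finite) set) = (*v) ` {A. surj ((*v) A)}"
proof (intro equalityI subsetI)
  fix f :: "'a ^ 'n \<Rightarrow> 'a ^ 'b" assume f: "f \<in> linear_surjections"
  then have "f = (*v) (matrix f)" by (auto simp: linear_surjections_def fun_eq_iff matrix_works)
  moreover from this have "surj ((*v) (matrix f))" using f by (simp add: linear_surjections_def)
  ultimately show "f \<in> (*v) ` {A. surj ((*v) A)}" by blast
qed (auto simp: linear_surjections_def)

lemma inj_matrix_vector_mult: "inj ((*v) :: 'a::{field,finite} ^ 'n::finite ^ 'b::finite \<Rightarrow> 'a ^ 'n \<Rightarrow> 'a ^ 'b)"
  by (rule injI) (simp add: matrix_eq fun_eq_iff)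

theorem corollary1p2:
  fixes S :: "('a::{field,finite} ^ 'n::finite) set"
    and \<tau> \<delta> :: real
  assumes "S \<noteq> {}"
    and "1 \<le> CARD('b::finite)" and "CARD('b) \<le> CARD('n)"
    and "0 < \<tau>" and "\<tau> \<le> 1"
    and "0 < \<delta>" and "\<delta> < 1"
    and "CARD('a) \<ge> 16 * (CARD('b) + 2)"
    and "mean_fibre TYPE('b) S \<ge> 192 * real (CARD('a)) ^ 2 / (\<tau> ^ 2 * \<delta>)"
  shows "unbalanced_proportion TYPE('b) S \<tau> < \<delta> \<and>
    measure_pmf.prob (pmf_of_set (UNIV :: ('a ^ 'n ^ 'b) set))
      {A. \<not> balanced S \<tau> (\<lambda>x. A *v x)} < \<delta>"
proof -
  define U where "U = {A :: 'a ^ 'n ^ 'b. \<not> balanced S \<tau> ((*v) A)}"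
  define Sj where "Sj = {A :: 'a ^ 'n ^ 'b. surj ((*v) A)}"
  define N where "N = CARD('a ^ 'n ^ 'b)"
  have N0: "0 < N" by (simp add: N_def)
  have q0: "0 < real CARD('a)" by simp
  have "mean_fibre TYPE('b) S = mean_fibre TYPE('b + bool) S * (real CARD('a))\<^sup>2"
    using q0 by (simp add: mean_fibre_def field_simps power2_eq_square)
  then have "192 \<le> \<tau>\<^sup>2 * \<delta> * mean_fibre TYPE('b + bool) S"
    using assms(9) assms(4,6) q0 by (simp add: field_simps)
  then have U: "48 * real (card U) \<le> 35 * \<delta> * real N"
    unfolding U_def N_def by (intro few_unbalanced_matrices assms)
  have "16 * 3 \<le> 16 * (CARD('b) + 2)" by (rule mult_le_mono2) simp
  from order_trans[OF this assms(8)] have "48 \<le> CARD('a)" by simp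
  then have "47 * (N - card Sj) \<le> (CARD('a) - 1) * (N - card Sj)"
    by (intro mult_le_mono1) simp
  also have "\<dots> \<le> N" unfolding N_def Sj_def by (rule card_surjective_matrices[OF assms(3)])
  finally have "46 * N \<le> 47 * card Sj" by simp
  then have Sj: "46 * real N \<le> 47 * real (card Sj)" by linarith
  have dN: "0 < \<delta> * real N" using assms(6) N0 by simp
  have "unbalanced_proportion TYPE('b) S \<tau> = real (card (U \<inter> Sj)) / real (card Sj)"
  proof -
    have card_mult: "card ((*v) ` A) = card A" for A :: "('a ^ 'n ^ 'b) set"
      by (rule card_image[OF inj_on_subset[OF inj_matrix_vector_mult subset_UNIV]])
    have "{L \<in> (linear_surjections :: ('a ^ 'n \<Rightarrow> 'a ^ 'b) set). \<not> balanced S \<tau> L} = (*v) ` (U \<inter> Sj)"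
      by (auto simp: linear_surjections_eq U_def Sj_def)
    then have "card {L \<in> (linear_surjections :: ('a ^ 'n \<Rightarrow> 'a ^ 'b) set). \<not> balanced S \<tau> L} = card (U \<inter> Sj)"
      by (simp only: card_mult)
    moreover have "card (linear_surjections :: ('a ^ 'n \<Rightarrow> 'a ^ 'b) set) = card Sj"
      unfolding linear_surjections_eq Sj_def by (rule card_mult)
    ultimately show ?thesis by (simp only: unbalanced_proportion_def)
  qed
  also have "\<dots> < \<delta>"
  proof -
    have "card (U \<inter> Sj) \<le> card U" by (intro card_mono) auto
    then have "48 * real (card (U \<inter> Sj)) \<le> 35 * (\<delta> * real N)" using U by simp
    moreover have "46 * (\<delta> * real N) \<le> 47 * (\<delta> * real (card Sj))"
      using mult_left_mono[OF Sj, of \<delta>] assms(6) by simp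
    ultimately have "real (card (U \<inter> Sj)) < \<delta> * real (card Sj)" using dN by linarith
    moreover have "0 < real (card Sj)" using Sj N0 by linarith
    ultimately show ?thesis by (simp add: field_simps)
  qed
  finally have 1: "unbalanced_proportion TYPE('b) S \<tau> < \<delta>" .
  have "measure_pmf.prob (pmf_of_set (UNIV :: ('a ^ 'n ^ 'b) set)) U = real (card U) / real N"
    by (subst measure_pmf_of_set) (auto simp: N_def)
  also have "\<dots> < \<delta>"
  proof -
    have "real (card U) < \<delta> * real N" using U dN by linarith
    then show ?thesis using N0 by (simp add: field_simps)
  qed
  finally have "measure_pmf.prob (pmf_of_set (UNIV :: ('a ^ 'n ^ 'b) set)) U < \<delta>" .
  then show ?thesis using 1 by (simp add: U_def)
qed

end
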